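(* Let $(X,\mathcal{B},\mu,T)$ be an ergodic measure theoretical dynamical system and let $\mathcal{U}$ be a cover of $X$. Then $h_\mu^e(\mathcal{U})=h_\mu^+(\mathcal{U})$.
   Context: A measure theoretical dynamical system is a four-tuple $(X,\mathcal{B},\mu,T)$, where $(X,\mathcal{B})$ is a standard space (i.e. isomorphic to $[0,1]$ with the Borel $\sigma$-algebra), $\mu$ is a probability measure on $(X,\mathcal{B})$ and $T$ is an invertible measure preserving transformation of $X$. A cover of $X$ is a finite collection of measurable sets whose union is $X$; a partition is a cover whose elements are mutually disjoint. A cover $\mathcal{U}$ is finer than a cover $\mathcal{V}$, written $\mathcal{U}\succeq\mathcal{V}$, if every element of $\mathcal{U}$ is contained in an element of $\mathcal{V}$. The join $\mathcal{U}\vee\mathcal{V}$ is the cover whose elements are the sets $U\cap V$ with $U\in\mathcal{U}$, $V\in\mathcal{V}$; $T^k(\mathcal{U})$ is the cover with elements $T^k(U)$, $U\in\mathcal{U}$; and $\mathcal{U}_0^{n-1}=\mathcal{U}\vee T^{-1}(\mathcal{U})\vee\dots\vee T^{-(n-1)}(\mathcal{U})$. For a cover $\mathcal{V}$ and $0<\epsilon<1$, $\mathcal{N}(\mathcal{V},\epsilon)$ is the minimum number of elements of $\mathcal{V}$ needed to cover $X$ up to a set of $\mu$-measure less than $\epsilon$. For an ergodic system, $h_\mu^e(\mathcal{U})=\lim_{n\to\infty}\frac1n\log\mathcal{N}(\mathcal{U}_0^{n-1},\epsilon)$ where $0<\epsilon<1$; it is part of the definition that this limit exists and does not depend on $\epsilon$.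 For a partition $\alpha$, $H_\mu(\alpha)=-\sum_{A\in\alpha}\mu(A)\log\mu(A)$, and $h_\mu(\alpha)=\lim_{n}\frac1n H_\mu(\alpha_0^{n-1})$ is the usual measure theoretical entropy of $\alpha$ with respect to $T$. For a cover $\mathcal{U}$, $h_\mu^+(\mathcal{U})=\inf\{h_\mu(\alpha) : \alpha \text{ a partition of } X,\ \alpha\succeq\mathcal{U}\}$. *)

theory Defs
  imports "HOL-Probability.Probability"
begin

section \<open>Ergodic systems on standard spaces\<close>

definition measurable_isomorphism :: "'a measure \<Rightarrow> 'b measure \<Rightarrow> ('a \<Rightarrow> 'b) \<Rightarrow> bool" where
  "measurable_isomorphism M N f \<longleftrightarrow>
     f \<in> measurable M N \<and> bij_betw f (space M) (space N) \<and>
     the_inv_into (space M) f \<in> measurable N M"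

definition standard_space :: "'a measure \<Rightarrow> bool" where
  "standard_space M \<longleftrightarrow>
     (\<exists>f :: 'a \<Rightarrow> real. measurable_isomorphism M (restrict_space borel {0..1}) f)"

locale measure_dynamical_system = prob_space M
  for M :: "'a measure" and T :: "'a \<Rightarrow> 'a" +
  assumes standard: "standard_space M"
    and invertible: "measurable_isomorphism M M T"
    and measure_preserving: "distr M M T = M"

locale ergodic_dynamical_system = measure_dynamical_system M T
  for M :: "'a measure" and T :: "'a \<Rightarrow> 'a" +
  assumes ergodic: "A \<in> sets M \<Longrightarrow> T -` A \<inter> space M = A \<Longrightarrow> prob A = 0 \<or> prob A = 1"

section \<open>Covers and partitions\<close>

definition is_cover :: "'a measure \<Rightarrow> 'a set set \<Rightarrow> bool" where
  "is_cover M U \<longleftrightarrow> finite U \<and> U \<subseteq> sets M \<and> \<Union>U = space M"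

text \<open>
  Unlike \<^const>\<open>partition_on\<close>, empty members are allowed.
\<close>
definition is_partition :: "'a measure \<Rightarrow> 'a set set \<Rightarrow> bool" where
  "is_partition M P \<longleftrightarrow> is_cover M P \<and> disjoint P"

definition finer_cover :: "'a set set \<Rightarrow> 'a set set \<Rightarrow> bool" where
  "finer_cover U V \<longleftrightarrow> (\<forall>A\<in>U. \<exists>B\<in>V. A \<subseteq> B)"

definition join_cover :: "'a set set \<Rightarrow> 'a set set \<Rightarrow> 'a set set" where
  "join_cover U V = {A \<inter> B |A B. A \<in> U \<and> B \<in> V}"

text \<open>
  The cover $T^{-k}(U)$. As \<open>T\<close> is a bijection of the space, the image of a set under the
  \<open>k\<close>-th iterate of the inverse of \<open>T\<close> is its preimage under the \<open>k\<close>-th iterate of \<open>T\<close>.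
\<close>
definition preimage_cover :: "'a measure \<Rightarrow> ('a \<Rightarrow> 'a) \<Rightarrow> nat \<Rightarrow> 'a set set \<Rightarrow> 'a set set" where
  "preimage_cover M T k U = (\<lambda>A. (T ^^ k) -` A \<inter> space M) ` U"

text \<open>
  \<open>iterated_cover M T U n\<close> is $U_0^{n-1} = U \vee T^{-1}(U) \vee \dots \vee T^{-(n-1)}(U)$;
  the empty join, for \<open>n = 0\<close>, is the trivial cover.
\<close>
primrec iterated_cover :: "'a measure \<Rightarrow> ('a \<Rightarrow> 'a) \<Rightarrow> 'a set set \<Rightarrow> nat \<Rightarrow> 'a set set" where
  "iterated_cover M T U 0 = {space M}"
| "iterated_cover M T U (Suc n) = join_cover (iterated_cover M T U n) (preimage_cover M T n U)"

section \<open>Entropy\<close>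

definition cover_number :: "'a measure \<Rightarrow> 'a set set \<Rightarrow> real \<Rightarrow> nat" where
  "cover_number M V \<epsilon> =
     (LEAST k. \<exists>W\<subseteq>V. finite W \<and> card W = k \<and> measure M (space M - \<Union>W) < \<epsilon>)"

definition cover_growth_rate ::
    "'a measure \<Rightarrow> ('a \<Rightarrow> 'a) \<Rightarrow> 'a set set \<Rightarrow> real \<Rightarrow> nat \<Rightarrow> real" where
  "cover_growth_rate M T U \<epsilon> n = ln (real (cover_number M (iterated_cover M T U n) \<epsilon>)) / real n"

text \<open>
  The entropy $h_\mu^e(U)$: the common limit, for all \<open>\<epsilon>\<close> in \<open>]0,1[\<close>, of the growth rates.
  That such a number exists is the predicate \<open>cover_entropy_e_well_defined\<close>; it is unique
  since limits are unique.
\<close>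
definition cover_entropy_e :: "'a measure \<Rightarrow> ('a \<Rightarrow> 'a) \<Rightarrow> 'a set set \<Rightarrow> real" where
  "cover_entropy_e M T U =
     (THE h. \<forall>\<epsilon>. 0 < \<epsilon> \<and> \<epsilon> < 1 \<longrightarrow> cover_growth_rate M T U \<epsilon> \<longlonglongrightarrow> h)"

definition cover_entropy_e_well_defined :: "'a measure \<Rightarrow> ('a \<Rightarrow> 'a) \<Rightarrow> 'a set set \<Rightarrow> bool" where
  "cover_entropy_e_well_defined M T U \<longleftrightarrow>
     (\<exists>h. \<forall>\<epsilon>. 0 < \<epsilon> \<and> \<epsilon> < 1 \<longrightarrow> cover_growth_rate M T U \<epsilon> \<longlonglongrightarrow> h)"

text \<open>
  Since \<open>ln 0 = 0\<close> in HOL, null sets contribute \<open>0\<close>, as under the usual convention.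
\<close>
definition static_entropy :: "'a measure \<Rightarrow> 'a set set \<Rightarrow> real" where
  "static_entropy M P = - (\<Sum>A\<in>P. measure M A * ln (measure M A))"

definition partition_entropy :: "'a measure \<Rightarrow> ('a \<Rightarrow> 'a) \<Rightarrow> 'a set set \<Rightarrow> real" where
  "partition_entropy M T P = lim (\<lambda>n. static_entropy M (iterated_cover M T P n) / real n)"

definition cover_entropy_plus :: "'a measure \<Rightarrow> ('a \<Rightarrow> 'a) \<Rightarrow> 'a set set \<Rightarrow> real" where
  "cover_entropy_plus M T U =
     Inf {partition_entropy M T P |P. is_partition M P \<and> finer_cover P U}"

end

theory Submission
  imports Defs
begin

text \<open>
  Every element of \<open>U\<^sub>0\<^sup>n\<^sup>-\<^sup>1\<close> is given by a word of length \<open>n\<close> over \<open>U\<close>, namely the set of points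
  whose orbit segment of length \<open>n\<close> follows that word. A partition finer than \<open>U\<close> chooses for each
  point one element of \<open>U\<close> that contains it, so the itineraries of the partition give words that
  the orbits follow.

  From partitions to covers. Let a partition finer than \<open>U\<close> have entropy below \<open>h\<close>. Markov's
  inequality for the information function says that a set of measure bounded away from \<open>0\<close> is
  covered by those itineraries of length \<open>n\<close> that have probability at least \<open>exp (- n h)\<close>, and there
  are at most \<open>exp (n h)\<close> of them. So the covering number is at most \<open>exp (n h)\<close> for all large \<open>n\<close>,
  though only for some \<open>\<epsilon> < 1\<close> that may be close to \<open>1\<close> (\<open>cover_number_le_exp_entropy\<close>).

  From covers to labellings. Suppose that for one \<open>\<epsilon> < 1\<close> the covering number is at most
  \<open>exp (n h)\<close> for infinitely many \<open>n\<close>. The sets covered for these \<open>n\<close> have measure at least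
  \<open>1 - \<epsilon>\<close>, so the points that lie in infinitely many of them form a set of positive measure, which
  almost every orbit enters. Hence, up to small measure, each point follows a word from a finite set
  \<open>W\<close> of long words that has at most about \<open>exp (n h)\<close> members of each length \<open>n\<close>
  (\<open>exists_word_selector\<close>). To fit these words together along an orbit, fix a set \<open>B\<close> of small
  positive measure, and starting from each visit to \<open>B\<close> put word after word until the next visit.
  The letters of these words label the points. The label of a point is found by scanning from its
  last visit to \<open>B\<close>, finitely many steps ago, so this is a measurable labelling, and all but a small
  fraction of a typical itinerary consists of complete words from \<open>W\<close>.

  Such itineraries are measured by a weight \<open>q\<close>: sum over all ways to cut a word into members of
  \<open>W\<close> and single letters, where a member \<open>w\<close> costs the factor \<open>exp (- \<kappa> * length w)\<close> with \<open>\<kappa>\<close>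
  slightly above \<open>h\<close>, and a single letter costs \<open>1 / (2 * card U)\<close>. As in Kraft's inequality, the
  words of each length have total weight at most \<open>1\<close> (\<open>sum_block_weight_le_1\<close>), while
  typical itineraries have weight at least about \<open>exp (- n h)\<close>
  (\<open>exists_compressible_labelling\<close>). Two conclusions follow. Comparing the distribution of the itineraries with \<open>q\<close> by Gibbs' inequality shows that the
  labelling has entropy at most \<open>h + \<delta>\<close> (\<open>exists_low_entropy_partition\<close>). Counting the words of
  weight at least \<open>exp (- n (h + \<delta>))\<close> shows that the covering number is at most \<open>exp (n (h + \<delta>))\<close>
  for every \<open>\<epsilon>\<close> and all large \<open>n\<close> (\<open>cover_number_eventually_le\<close>).

  So if the growth rates were infinitely often below some \<open>h < cover_entropy_plus M T U\<close>, there would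
  be a partition finer than \<open>U\<close> with entropy below \<open>cover_entropy_plus M T U\<close>; and if
  \<open>h > cover_entropy_plus M T U\<close>, the first step and the second conclusion bound the growth rates for
  every \<open>\<epsilon>\<close> by \<open>h\<close> from some \<open>n\<close> on. The set \<open>B\<close> exists unless the measures of all non-null sets are
  bounded below by some \<open>\<eta> > 0\<close>. In that case at most \<open>1 / \<eta>\<close> itineraries have positive probability,
  whatever their length, and both entropies vanish.
\<close>

section \<open>Weights on words\<close>

definition words :: "'b set \<Rightarrow> nat \<Rightarrow> 'b list set" where
  "words A n = {v. set v \<subseteq> A \<and> length v = n}"

lemma finite_words: "finite A \<Longrightarrow> finite (words A n)"
  unfolding words_def by (rule finite_lists_length_eq)

lemma words_0 [simp]: "words A 0 = {[]}"
  by (auto simp: words_def)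

lemma words_Suc: "words A (Suc n) = (\<lambda>(a, v). a # v) ` (A \<times> words A n)"
  by (auto simp: words_def length_Suc_conv image_iff)

lemma sum_words_Suc:
  assumes "finite A"
  shows "(\<Sum>v\<in>words A (Suc n). f v) = (\<Sum>a\<in>A. \<Sum>v\<in>words A n. f (a # v))"
proof -
  have "(\<Sum>v\<in>words A (Suc n). f v) = (\<Sum>p\<in>A \<times> words A n. f (fst p # snd p))"
    unfolding words_Suc by (subst sum.reindex) (auto simp: inj_on_def case_prod_beta)
  then show ?thesis
    by (simp add: sum.cartesian_product case_prod_beta)
qed

text \<open>
  The total weight of all ways to cut a word into blocks, where a block is a member \<open>w\<close> of \<open>W\<close>, of
  weight \<open>exp (- k * length w)\<close>, or a single letter, of weight \<open>s\<close>. The second summand collects the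
  cuttings whose first block is in \<open>W\<close>; the letter \<open>a\<close> is already gone from \<open>v\<close>, hence
  \<open>length w - 1\<close>.
\<close>
fun block_weight :: "real \<Rightarrow> real \<Rightarrow> 'b list set \<Rightarrow> 'b list \<Rightarrow> real" where
  "block_weight s k W [] = 1"
| "block_weight s k W (a # v) = s * block_weight s k W v +
     (\<Sum>w\<in>{w \<in> W. take (length w) (a # v) = w}.
        exp (- k * length w) * block_weight s k W (drop (length w - 1) v))"

lemma block_weight_nonneg: "(s::real) \<ge> 0 \<Longrightarrow> block_weight s k W v \<ge> 0"
  by (induction s k W v rule: block_weight.induct) (auto intro!: add_nonneg_nonneg sum_nonneg mult_nonneg_nonneg)

lemma block_weight_Cons:
  "s \<ge> 0 \<Longrightarrow> s * block_weight s k W v \<le> block_weight s k W (a # v)"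
  by (auto intro!: sum_nonneg mult_nonneg_nonneg block_weight_nonneg)

lemma block_weight_pos:
  assumes "s > 0"
  shows "block_weight s k W v > 0"
proof (induction v)
  case (Cons a v)
  then have "0 < s * block_weight s k W v" using assms by simp
  also have "\<dots> \<le> block_weight s k W (a # v)" using assms by (intro block_weight_Cons) simp
  finally show ?case .
qed simp

lemma block_weight_append:
  fixes s k :: real
  assumes "s \<ge> 0" "finite W" "w \<in> W" "w \<noteq> []"
  shows "exp (- k * length w) * block_weight s k W v \<le> block_weight s k W (w @ v)"
proof -
  obtain a w' where w: "w = a # w'" using assms by (cases w) auto
  let ?F = "{u \<in> W. take (length u) (a # (w' @ v)) = u}"
  have "exp (- k * length w) * block_weight s k W v =
      (\<Sum>u\<in>{w}. exp (- k * length u) * block_weight s k W (drop (length u - 1) (w' @ v)))"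
    by (simp add: w)
  also have "\<dots> \<le> (\<Sum>u\<in>?F. exp (- k * length u) * block_weight s k W (drop (length u - 1) (w' @ v)))"
    using assms by (intro sum_mono2) (auto simp: w intro!: mult_nonneg_nonneg block_weight_nonneg)
  also have "\<dots> \<le> block_weight s k W (a # (w' @ v))"
    using assms by (simp add: block_weight_nonneg)
  finally show ?thesis by (simp add: w)
qed

text \<open>
  Kraft's inequality for blocks: if all possible first blocks together weigh at most \<open>1\<close>, then by
  induction so do the cut words of any fixed length, because what remains after the first block is
  a word of a smaller fixed length.
\<close>
lemma sum_block_weight_le_1:
  fixes s k :: real
  assumes "finite A" "finite W" "[] \<notin> W" "s \<ge> 0"
    and s: "s * card A \<le> 1/2" and W: "(\<Sum>w\<in>W. exp (- k * length w)) \<le> 1/2"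
  shows "(\<Sum>v\<in>words A N. block_weight s k W v) \<le> 1"
proof (induction N rule: less_induct)
  case (less N)
  show ?case
  proof (cases N)
    case 0
    then show ?thesis by simp
  next
    case (Suc n)
    let ?q = "block_weight s k W"
    let ?V = "words A N"
    have fin: "finite ?V" using assms by (simp add: finite_words)
    have eq: "?q v = s * ?q (tl v) + (\<Sum>w\<in>{w \<in> W. take (length w) v = w}.
        exp (- k * length w) * ?q (drop (length w) v))" if v_in: "v \<in> ?V" for v
    proof -
      obtain a u where v: "v = a # u" using v_in Suc by (cases v) (auto simp: words_def)
      have "drop (length w - 1) u = drop (length w) v" if "w \<in> W" for w
        using that assms(3) v by (cases w) auto
      then show ?thesis by (simp add: v)
    qed
    have "(\<Sum>v\<in>?V. s * ?q (tl v)) = s * card A * (\<Sum>v\<in>words A n. ?q v)"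
      unfolding Suc sum_words_Suc[OF assms(1)] by (simp add: sum_distrib_left mult_ac)
    also have "\<dots> \<le> s * card A * 1"
      using less.IH[of n] Suc assms by (intro mult_left_mono) auto
    finally have first: "(\<Sum>v\<in>?V. s * ?q (tl v)) \<le> 1/2" using s by simp
    \<comment> \<open>Words that start with \<open>w\<close> are determined by their remainder, so the induction hypothesis applies.\<close>
    have inner: "(\<Sum>v\<in>{v \<in> ?V. take (length w) v = w}. ?q (drop (length w) v)) \<le> 1" if "w \<in> W" for w
    proof -
      have "w \<noteq> []" using that assms by auto
      let ?S = "{v \<in> ?V. take (length w) v = w}"
      have inj: "inj_on (drop (length w)) ?S"
        by (rule inj_onI) (metis (mono_tags, lifting) append_take_drop_id mem_Collect_eq)
      have "(\<Sum>v\<in>?S. ?q (drop (length w) v)) = (\<Sum>u\<in>drop (length w) ` ?S. ?q u)"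
        using inj by (simp add: sum.reindex)
      also have "\<dots> \<le> (\<Sum>u\<in>words A (N - length w). ?q u)"
        using assms by (intro sum_mono2 finite_words block_weight_nonneg)
          (auto simp: words_def dest: in_set_dropD)
      also have "\<dots> \<le> 1"
        using less.IH[of "N - length w"] \<open>w \<noteq> []\<close> Suc by simp
      finally show ?thesis .
    qed
    have "(\<Sum>v\<in>?V. \<Sum>w\<in>{w \<in> W. take (length w) v = w}. exp (- k * length w) * ?q (drop (length w) v))
        = (\<Sum>w\<in>W. \<Sum>v\<in>{v \<in> ?V. take (length w) v = w}. exp (- k * length w) * ?q (drop (length w) v))"
      using fin assms(2) by (rule sum.swap_restrict)
    also have "\<dots> = (\<Sum>w\<in>W. exp (- k * length w) *
        (\<Sum>v\<in>{v \<in> ?V. take (length w) v = w}. ?q (drop (length w) v)))"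
      by (simp add: sum_distrib_left)
    also have "\<dots> \<le> (\<Sum>w\<in>W. exp (- k * length w) * 1)"
      using inner by (intro sum_mono mult_left_mono) auto
    finally have second: "(\<Sum>v\<in>?V. \<Sum>w\<in>{w \<in> W. take (length w) v = w}.
        exp (- k * length w) * ?q (drop (length w) v)) \<le> 1/2" using W by simp
    show ?thesis
      using first second by (simp add: eq sum.distrib)
  qed
qed

section \<open>Averages of subadditive sequences\<close>

text \<open>
  Fekete's lemma: splitting \<open>n\<close> into blocks of length \<open>m\<close> bounds \<open>a n / n\<close> by \<open>a m / m\<close> up to an
  error of order \<open>1 / n\<close>, so the limit is the infimum.
\<close>
lemma subadditive_convergent:
  fixes a :: "nat \<Rightarrow> real"
  assumes nonneg: "\<And>n. a n \<ge> 0" and sub: "\<And>m n. a (m + n) \<le> a m + a n"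
  shows "convergent (\<lambda>n. a n / n)"
proof -
  define l where "l = Inf ((\<lambda>n. a n / real n) ` {1..})"
  have bdd: "bdd_below ((\<lambda>n. a n / real n) ` {1..})"
    by (rule bdd_belowI[of _ 0]) (use nonneg in auto)
  have lower: "l \<le> a n / n" if "n \<ge> 1" for n
    unfolding l_def by (rule cInf_lower) (use that bdd in auto)
  have mult: "a (k * m + r) \<le> k * a m + a r" for k m r
  proof (induction k)
    case (Suc k)
    have "a (Suc k * m + r) \<le> a m + a (k * m + r)"
      using sub[of m "k * m + r"] by (simp add: algebra_simps)
    then show ?case using Suc by (simp add: algebra_simps)
  qed simp
  have "(\<lambda>n. a n / n) \<longlonglongrightarrow> l"
  proof (rule LIMSEQ_I)
    fix e :: real assume e: "e > 0"
    have "\<exists>y\<in>(\<lambda>n. a n / real n) ` {1..}. y < l + e/2"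
      by (rule cInf_lessD) (use e in \<open>auto simp: l_def\<close>)
    then obtain m where m: "m \<ge> 1" "a m / m < l + e/2" by auto
    define C where "C = (\<Sum>r<m. a r)"
    have C: "a r \<le> C" if "r < m" for r
      unfolding C_def using that nonneg by (intro member_le_sum) auto
    have upper: "a n / n \<le> a m / m + C / n" if "n \<ge> 1" for n
    proof -
      have "a n \<le> (n div m) * a m + a (n mod m)"
        using mult[of "n div m" m "n mod m"] by simp
      also have "\<dots> \<le> (n / m) * a m + C"
        using nonneg m C[of "n mod m"]
        by (intro add_mono mult_right_mono) (auto simp: of_nat_div_le_of_nat)
      finally have "a n / n \<le> ((n / m) * a m + C) / n" by (intro divide_right_mono) auto
      also have "\<dots> = a m / m + C / n" using that m by (simp add: field_simps)
      finally show ?thesis .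
    qed
    have "(\<lambda>n. C / real n) \<longlonglongrightarrow> 0" by (rule lim_const_over_n)
    then have "\<forall>\<^sub>F n in sequentially. C / real n < e/2"
      using e by (intro order_tendstoD(2)) auto
    then obtain N where N: "\<And>n. n \<ge> N \<Longrightarrow> C / real n < e/2"
      by (auto simp: eventually_sequentially)
    show "\<exists>N. \<forall>n\<ge>N. norm (a n / real n - l) < e"
    proof (intro exI[of _ "max N 1"] allI impI)
      fix n assume "n \<ge> max N 1"
      then have "a n / n \<le> a m / m + C / n" "C / n < e/2" "l \<le> a n / n"
        using upper[of n] N[of n] lower[of n] by auto
      then show "norm (a n / real n - l) < e"
        unfolding real_norm_def using m(2) e by linarith
    qed
  qed
  then show ?thesis by (rule convergentI)
qed

section \<open>Iterates, the inverse system and recurrence\<close>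

context measure_dynamical_system
begin

lemma T_measurable [measurable]: "T \<in> measurable M M"
  using invertible by (simp add: measurable_isomorphism_def)

lemma T_power_measurable [measurable]: "T ^^ n \<in> measurable M M"
  by (induction n) auto

lemma T_power_space: "x \<in> space M \<Longrightarrow> (T ^^ n) x \<in> space M"
  using measurable_space[OF T_power_measurable] .

lemma prob_vimage_T_power:
  assumes "A \<in> sets M"
  shows "prob ((T ^^ n) -` A \<inter> space M) = prob A"
proof (induction n)
  case 0
  then show ?case using sets.sets_into_space[OF assms] by (simp add: Int_absorb2)
next
  case (Suc n)
  let ?B = "(T ^^ n) -` A \<inter> space M"
  have "?B \<in> sets M" using assms by measurable
  moreover have "(T ^^ Suc n) -` A \<inter> space M = T -` ?B \<inter> space M"
    unfolding funpow_Suc_right using T_power_space[of _ 1] by auto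
  moreover have "prob (T -` ?B \<inter> space M) = prob ?B"
    using measure_distr[of T M M ?B] calculation(1) by (simp add: measure_preserving)
  ultimately show ?case using Suc by (simp only:)
qed

abbreviation S :: "'a \<Rightarrow> 'a" where
  "S \<equiv> the_inv_into (space M) T"

lemma bij_betw_T: "bij_betw T (space M) (space M)"
  using invertible by (simp add: measurable_isomorphism_def)

lemma S_T [simp]: "x \<in> space M \<Longrightarrow> S (T x) = x"
  using bij_betw_T by (simp add: bij_betw_def the_inv_into_f_f)

lemma T_S [simp]: "x \<in> space M \<Longrightarrow> T (S x) = x"
  using bij_betw_T by (simp add: bij_betw_def f_the_inv_into_f)

lemma S_measurable: "S \<in> measurable M M"
  using invertible by (simp add: measurable_isomorphism_def)

lemma inverse_system: "measure_dynamical_system M S"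
proof
  show "standard_space M" by (rule standard)
  have "the_inv_into (space M) S x = T x" if "x \<in> space M" for x
    using that T_power_space[of x 1] bij_betw_the_inv_into[OF bij_betw_T]
    by (intro the_inv_into_f_eq) (use bij_betw_T in \<open>auto simp: bij_betw_def\<close>)
  then have "the_inv_into (space M) S \<in> measurable M M"
    by (subst measurable_cong[where g = T]) auto
  then show "measurable_isomorphism M M S"
    using S_measurable bij_betw_the_inv_into[OF bij_betw_T]
    by (simp add: measurable_isomorphism_def)
  have "distr M M S = distr (distr M M T) M S" by (simp add: measure_preserving)
  also have "\<dots> = distr M M (S \<circ> T)" using S_measurable by (simp add: distr_distr)
  also have "\<dots> = distr M M (\<lambda>x. x)" by (intro distr_cong) auto
  finally show "distr M M S = M" by simp
qed

lemma T_power_S_power: "x \<in> space M \<Longrightarrow> (T ^^ n) ((S ^^ n) x) = x"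
proof (induction n)
  case (Suc n)
  have "(S ^^ n) x \<in> space M"
    using measure_dynamical_system.T_power_space[OF inverse_system] Suc by auto
  moreover have "(T ^^ Suc n) ((S ^^ Suc n) x) = (T ^^ n) (T (S ((S ^^ n) x)))"
    by (simp only: funpow_Suc_right[of n T] funpow.simps(2)[of n S] comp_apply)
  ultimately show ?case using Suc by simp
qed simp

end

context ergodic_dynamical_system
begin

lemma inverse_ergodic: "ergodic_dynamical_system M S"
proof -
  interpret S: measure_dynamical_system M S by (rule inverse_system)
  show ?thesis
  proof
    fix A assume A: "A \<in> sets M" "S -` A \<inter> space M = A"
    have "T x \<in> A \<longleftrightarrow> x \<in> A" if "x \<in> space M" for x
    proof -
      have "T x \<in> space M" using T_power_space[of x 1] that by simp
      then have "T x \<in> A \<longleftrightarrow> S (T x) \<in> A" using A(2) by blast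
      then show ?thesis using that by simp
    qed
    then have "T -` A \<inter> space M = A"
      using sets.sets_into_space[OF A(1)] by auto
    then show "prob A = 0 \<or> prob A = 1" using A ergodic by auto
  qed
qed

text \<open>
  This is how ergodicity enters. The points that visit \<open>G\<close> infinitely often form a strictly
  invariant set. It has the same measure as the set of points that visit \<open>G\<close> at all, since the sets
  of points visiting \<open>G\<close> at some time \<open>\<ge> k\<close> are preimages of each other and decrease with \<open>k\<close>.
\<close>
lemma prob_hitting:
  assumes [measurable]: "G \<in> sets M" and pos: "prob G > 0"
  shows "prob {x \<in> space M. \<exists>j. (T ^^ j) x \<in> G} = 1"
proof -
  define D where "D k = {x \<in> space M. \<exists>j\<ge>k. (T ^^ j) x \<in> G}" for k
  have D [measurable]: "D k \<in> sets M" for k unfolding D_def by measurable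
  have D_eq: "D k = (T ^^ k) -` D 0 \<inter> space M" for k
  proof -
    have "(\<exists>j\<ge>k. (T ^^ j) x \<in> G) \<longleftrightarrow> (\<exists>j. (T ^^ j) ((T ^^ k) x) \<in> G)" for x
      by (auto simp: le_iff_add funpow_add[of _ k] add.commute[of k])
    then show ?thesis unfolding D_def using T_power_space by auto
  qed
  have prob_D: "(\<lambda>k. prob (D k)) = (\<lambda>_. prob (D 0))"
    by (rule ext, subst D_eq) (rule prob_vimage_T_power, simp)
  have "G \<subseteq> D 0"
    unfolding D_def using sets.sets_into_space[OF assms(1)] by (auto intro!: exI[of _ 0])
  then have D0: "prob G \<le> prob (D 0)" by (intro finite_measure_mono) auto
  have "decseq D" unfolding D_def decseq_def by (blast intro: order_trans)
  then have "(\<lambda>k. prob (D k)) \<longlonglongrightarrow> prob (\<Inter>k. D k)"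
    by (intro finite_Lim_measure_decseq) auto
  then have "prob (\<Inter>k. D k) = prob (D 0)"
    unfolding prob_D by (rule LIMSEQ_unique[OF _ tendsto_const])
  moreover have "prob (\<Inter>k. D k) = 0 \<or> prob (\<Inter>k. D k) = 1"
  proof (rule ergodic)
    show "(\<Inter>k. D k) \<in> sets M" by measurable
    have shift: "(\<exists>j\<ge>k. P (Suc j)) \<longleftrightarrow> (\<exists>j\<ge>Suc k. P j)" for P :: "nat \<Rightarrow> bool" and k
      by (metis Suc_le_D Suc_le_mono)
    have "T x \<in> D k \<longleftrightarrow> x \<in> D (Suc k)" if "x \<in> space M" for x k
    proof -
      have "(\<exists>j\<ge>k. (T ^^ j) (T x) \<in> G) \<longleftrightarrow> (\<exists>j\<ge>k. (T ^^ Suc j) x \<in> G)"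
        unfolding funpow_Suc_right by simp
      also have "\<dots> \<longleftrightarrow> (\<exists>j\<ge>Suc k. (T ^^ j) x \<in> G)"
        by (rule shift)
      finally have "(\<exists>j\<ge>k. (T ^^ j) (T x) \<in> G) \<longleftrightarrow> (\<exists>j\<ge>Suc k. (T ^^ j) x \<in> G)" .
      then show ?thesis unfolding D_def using that T_power_space[of x 1] by auto
    qed
    then have "T -` (\<Inter>k. D k) \<inter> space M = (\<Inter>k. D (Suc k)) \<inter> space M"
      by (fastforce simp: set_eq_iff)
    also have "\<dots> = (\<Inter>k. D k)"
    proof
      have "D (Suc k) \<subseteq> D k" for k unfolding D_def by (blast intro: Suc_leD)
      then show "(\<Inter>k. D (Suc k)) \<inter> space M \<subseteq> (\<Inter>k. D k)" by fast
      have "D 0 \<subseteq> space M" unfolding D_def by auto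
      then show "(\<Inter>k. D k) \<subseteq> (\<Inter>k. D (Suc k)) \<inter> space M" by fast
    qed
    finally show "T -` (\<Inter>k. D k) \<inter> space M = (\<Inter>k. D k)" .
  qed
  ultimately have "prob (D 0) = 1" using D0 pos by auto
  then show ?thesis unfolding D_def by simp
qed

end

section \<open>Itineraries\<close>

definition itinerary :: "('a \<Rightarrow> 'a) \<Rightarrow> ('a \<Rightarrow> 'b) \<Rightarrow> nat \<Rightarrow> 'a \<Rightarrow> 'b list" where
  "itinerary T b n x = map (\<lambda>i. b ((T ^^ i) x)) [0..<n]"

lemma length_itinerary [simp]: "length (itinerary T b n x) = n"
  by (simp add: itinerary_def)

lemma itinerary_0 [simp]: "itinerary T b 0 x = []"
  by (simp add: itinerary_def)

lemma nth_itinerary: "i < n \<Longrightarrow> itinerary T b n x ! i = b ((T ^^ i) x)"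
  by (simp add: itinerary_def)

lemma itinerary_append:
  "itinerary T b (m + n) x = itinerary T b m x @ itinerary T b n ((T ^^ m) x)"
proof (rule nth_equalityI)
  fix i assume "i < length (itinerary T b (m + n) x)"
  moreover have "(T ^^ (i - m)) ((T ^^ m) x) = (T ^^ i) x" if "m \<le> i"
    using that by (simp flip: funpow_add[THEN fun_cong, unfolded comp_apply])
  ultimately show "itinerary T b (m + n) x ! i = (itinerary T b m x @ itinerary T b n ((T ^^ m) x)) ! i"
    by (auto simp: nth_append nth_itinerary)
qed simp

lemma itinerary_Suc: "itinerary T b (Suc n) x = b x # itinerary T b n (T x)"
  using itinerary_append[of T b 1 n x] by (simp add: itinerary_def)

text \<open>
  Unlike an itinerary, a followed word is not determined by the point, as the elements of a cover may overlap.
\<close>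
definition follows :: "('a \<Rightarrow> 'a) \<Rightarrow> 'a \<Rightarrow> 'a set list \<Rightarrow> bool" where
  "follows T x w \<longleftrightarrow> (\<forall>i<length w. (T ^^ i) x \<in> w ! i)"

lemma follows_Nil [simp]: "follows T x []"
  by (simp add: follows_def)

lemma follows_Cons: "follows T x (A # w) \<longleftrightarrow> x \<in> A \<and> follows T (T x) w"
  unfolding follows_def by (auto simp: less_Suc_eq_0_disj funpow_swap1)

lemma follows_append:
  "follows T x (u @ w) \<longleftrightarrow> follows T x u \<and> follows T ((T ^^ length u) x) w"
  by (induction u arbitrary: x) (auto simp: follows_Cons funpow_swap1)

lemma follows_iff_itinerary:
  "follows T x (map (\<lambda>a. {y \<in> X. b y = a}) v) \<longleftrightarrow>
     (\<forall>i<length v. (T ^^ i) x \<in> X) \<and> itinerary T b (length v) x = v"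
  by (auto simp: follows_def list_eq_iff_nth_eq nth_itinerary)

lemma words_Suc_snoc: "words A (Suc n) = (\<lambda>(v, a). v @ [a]) ` (words A n \<times> A)"
proof -
  have "v \<in> (\<lambda>(v, a). v @ [a]) ` (words A n \<times> A)" if "v \<in> words A (Suc n)" for v
    using that by (cases v rule: rev_cases) (auto simp: words_def image_iff)
  then show ?thesis by (auto simp: words_def)
qed

lemma words_image: "words (f ` A) n = map f ` words A n"
proof -
  have "v \<in> map f ` words A n" if "v \<in> words (f ` A) n" for v
  proof -
    have "v \<in> lists (f ` A)" using that by (auto simp: words_def)
    then obtain u where "u \<in> lists A" "v = map f u" by (auto simp: lists_image)
    then show ?thesis using that by (auto simp: words_def)
  qed
  moreover have "map f u \<in> words (f ` A) n" if "u \<in> words A n" for u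
    using that by (auto simp: words_def)
  ultimately show ?thesis by blast
qed

lemma words_append:
  "words A (m + n) = (\<lambda>(u, v). u @ v) ` (words A m \<times> words A n)"
proof -
  have "v \<in> (\<lambda>(u, v). u @ v) ` (words A m \<times> words A n)" if "v \<in> words A (m + n)" for v
    using that by (intro rev_image_eqI[of "(take m v, drop m v)"])
      (auto simp: words_def dest: in_set_takeD in_set_dropD)
  then show ?thesis by (auto simp: words_def)
qed

lemma sum_words_append:
  "(\<Sum>w\<in>words A (m + n). f w) = (\<Sum>u\<in>words A m. \<Sum>v\<in>words A n. f (u @ v))"
proof -
  have "inj_on (\<lambda>p. fst p @ snd p) (words A m \<times> words A n)"
    by (auto simp: inj_on_def words_def)
  then show ?thesis
    unfolding words_append by (simp add: sum.reindex sum.cartesian_product case_prod_beta')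
qed

lemma iterated_cover_eq:
  "iterated_cover M T U n = (\<lambda>v. {x \<in> space M. follows T x v}) ` words U n"
proof (induction n)
  case 0
  then show ?case by simp
next
  case (Suc n)
  have eq: "{x \<in> space M. follows T x (v @ [A])} =
      {x \<in> space M. follows T x v} \<inter> ((T ^^ n) -` A \<inter> space M)" if "v \<in> words U n" for v A
    using that by (auto simp: follows_append follows_Cons words_def)
  show ?case
    unfolding iterated_cover.simps Suc words_Suc_snoc join_cover_def preimage_cover_def image_image
  proof (safe, goal_cases)
    case (1 _ _ _ v A)
    then show ?case using eq[of v A] by (intro rev_image_eqI[of "(v, A)"]) auto
  next
    case (2 _ v A)
    then show ?case using eq[of v A] by auto
  qed
qed

lemma (in measure_dynamical_system) follows_measurable:
  assumes "U \<subseteq> sets M" "set w \<subseteq> U"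
  shows "{x \<in> space M. follows T x w} \<in> sets M"
proof -
  have "{x \<in> space M. (T ^^ i) x \<in> w ! i} \<in> sets M" if "i < length w" for i
  proof -
    have [measurable]: "w ! i \<in> sets M" using assms that nth_mem by blast
    show ?thesis by measurable
  qed
  then have "{x \<in> space M. \<forall>i\<in>{..<length w}. (T ^^ i) x \<in> w ! i} \<in> sets M"
    by (rule sets.sets_Collect_finite_All) auto
  also have "{x \<in> space M. \<forall>i\<in>{..<length w}. (T ^^ i) x \<in> w ! i} = {x \<in> space M. follows T x w}"
    by (auto simp: follows_def)
  finally show ?thesis .
qed

section \<open>Entropy of a labelling\<close>

text \<open>
  Partitions are handled through the maps that send a point to the name of its element. Then the
  elements of an iterated partition are indexed by words, and empty elements do no harm.
\<close>
definition labelling :: "'a measure \<Rightarrow> 'b set \<Rightarrow> ('a \<Rightarrow> 'b) \<Rightarrow> bool" where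
  "labelling M A b \<longleftrightarrow> finite A \<and> b \<in> measurable M (count_space UNIV) \<and> b ` space M \<subseteq> A"

definition label_partition :: "'a measure \<Rightarrow> 'b set \<Rightarrow> ('a \<Rightarrow> 'b) \<Rightarrow> 'a set set" where
  "label_partition M A b = (\<lambda>a. {x \<in> space M. b x = a}) ` A"

lemma label_partition_is_partition:
  assumes "labelling M A b"
  shows "is_partition M (label_partition M A b)"
proof -
  have [measurable]: "b \<in> measurable M (count_space UNIV)" using assms by (simp add: labelling_def)
  have "{x \<in> space M. b x = a} \<in> sets M" for a by measurable
  then show ?thesis
    using assms unfolding labelling_def label_partition_def is_partition_def is_cover_def
    by (auto simp: disjoint_def)
qed

lemma label_partition_finer:
  assumes "\<And>x. x \<in> space M \<Longrightarrow> x \<in> b x"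
  shows "finer_cover (label_partition M U b) U"
  unfolding finer_cover_def
proof
  fix D assume "D \<in> label_partition M U b"
  then obtain A where A: "A \<in> U" "D = {x \<in> space M. b x = A}" by (auto simp: label_partition_def)
  then have "D \<subseteq> A" using assms by auto
  then show "\<exists>A\<in>U. D \<subseteq> A" using A(1) by (rule bexI)
qed

lemma partition_labelling:
  assumes "is_partition M P"
  obtains b where "labelling M P b" "label_partition M P b = P" "\<And>x. x \<in> space M \<Longrightarrow> x \<in> b x"
proof -
  define b where "b x = (THE A. A \<in> P \<and> x \<in> A)" for x
  have P: "finite P" "P \<subseteq> sets M" "\<Union>P = space M" "disjoint P"
    using assms by (auto simp: is_partition_def is_cover_def)
  have ex1: "\<exists>!A. A \<in> P \<and> x \<in> A" if x: "x \<in> space M" for x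
  proof -
    obtain A where "A \<in> P" "x \<in> A" using x P(3) by auto
    moreover have "B = A" if "B \<in> P" "x \<in> B" for B
      using disjointD[OF P(4) that(1) \<open>A \<in> P\<close>] that(2) \<open>x \<in> A\<close> by auto
    ultimately show ?thesis by blast
  qed
  have b: "b x \<in> P" "x \<in> b x" if "x \<in> space M" for x
    using theI'[OF ex1[OF that]] by (auto simp: b_def)
  have fiber: "{x \<in> space M. b x = A} = A" if "A \<in> P" for A
  proof
    show "{x \<in> space M. b x = A} \<subseteq> A" using b(2) by auto
    show "A \<subseteq> {x \<in> space M. b x = A}"
    proof
      fix x assume x: "x \<in> A"
      then have "x \<in> space M" using that P(3) by auto
      then show "x \<in> {x \<in> space M. b x = A}"
        using ex1[of x] b[of x] x that by auto
    qed
  qed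
  have "b \<in> measurable M (count_space P)"
  proof (rule measurable_count_space_eq2[THEN iffD2])
    show "b \<in> space M \<rightarrow> P \<and> (\<forall>a\<in>P. b -` {a} \<inter> space M \<in> sets M)"
    proof (intro conjI ballI)
      fix A assume "A \<in> P"
      moreover have "b -` {A} \<inter> space M = {x \<in> space M. b x = A}" by auto
      ultimately show "b -` {A} \<inter> space M \<in> sets M" using fiber P(2) by auto
    qed (use b in auto)
  qed (rule P(1))
  then have "(\<lambda>x. id (b x)) \<in> measurable M (count_space UNIV)"
    by (rule measurable_compose) simp
  then have "b \<in> measurable M (count_space UNIV)" by simp
  then have "labelling M P b" using P b by (auto simp: labelling_def)
  moreover have "label_partition M P b = P" unfolding label_partition_def using fiber by auto
  ultimately show thesis using b that by blast
qed

context measure_dynamical_system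
begin

definition word_prob :: "('a \<Rightarrow> 'b) \<Rightarrow> 'b list \<Rightarrow> real" where
  "word_prob b v = prob {x \<in> space M. itinerary T b (length v) x = v}"

lemma itinerary_measurable:
  assumes "b \<in> measurable M (count_space UNIV)"
  shows "{x \<in> space M. itinerary T b n x = v} \<in> sets M"
proof (cases "length v = n")
  case True
  note [measurable] = assms
  have "{x \<in> space M. \<forall>i\<in>{..<n}. b ((T ^^ i) x) = v ! i} \<in> sets M" by measurable
  moreover have "itinerary T b n x = v \<longleftrightarrow> (\<forall>i\<in>{..<n}. b ((T ^^ i) x) = v ! i)" for x
    using True by (auto simp: list_eq_iff_nth_eq nth_itinerary)
  ultimately show ?thesis by simp
next
  case False
  then have empty: "{x \<in> space M. itinerary T b n x = v} = {}" by auto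
  show ?thesis unfolding empty by simp
qed

lemma itinerary_in_words:
  assumes "labelling M A b" "x \<in> space M"
  shows "itinerary T b n x \<in> words A n"
  using assms T_power_space[OF assms(2)] by (auto simp: labelling_def words_def itinerary_def)

lemma expectation_itinerary:
  fixes f :: "'b list \<Rightarrow> real"
  assumes "labelling M A b"
  shows "integrable M (\<lambda>x. f (itinerary T b n x))"
    and "expectation (\<lambda>x. f (itinerary T b n x)) = (\<Sum>v\<in>words A n. word_prob b v * f v)"
proof -
  let ?c = "\<lambda>v. {x \<in> space M. itinerary T b n x = v}"
  let ?g = "\<lambda>x. \<Sum>v\<in>words A n. f v * indicator (?c v) x"
  have fin: "finite (words A n)" using assms by (simp add: labelling_def finite_words)
  have meas [measurable]: "?c v \<in> sets M" for v
    using assms by (intro itinerary_measurable) (simp add: labelling_def)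
  have eq: "f (itinerary T b n x) = ?g x" if "x \<in> space M" for x
  proof -
    have "?g x = (\<Sum>v\<in>words A n. if itinerary T b n x = v then f v else 0)"
      using that by (intro sum.cong) (auto simp: indicator_def)
    also have "\<dots> = f (itinerary T b n x)"
      using fin itinerary_in_words[OF assms that, of n] by (simp add: sum.delta')
    finally show ?thesis by simp
  qed
  have int: "integrable M (\<lambda>x. f v * indicator (?c v) x)" for v
    by (intro integrable_mult_right integrable_real_indicator) (auto simp: emeasure_eq_measure)
  have "integrable M ?g" by (intro Bochner_Integration.integrable_sum int)
  then show "integrable M (\<lambda>x. f (itinerary T b n x))"
    by (subst Bochner_Integration.integrable_cong[OF refl eq]) auto
  have "expectation (\<lambda>x. f (itinerary T b n x)) = expectation ?g"
    by (intro Bochner_Integration.integral_cong refl eq)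
  also have "\<dots> = (\<Sum>v\<in>words A n. expectation (\<lambda>x. f v * indicator (?c v) x))"
    by (intro Bochner_Integration.integral_sum int)
  also have "\<dots> = (\<Sum>v\<in>words A n. word_prob b v * f v)"
    by (intro sum.cong refl) (auto simp: word_prob_def words_def)
  finally show "expectation (\<lambda>x. f (itinerary T b n x)) = (\<Sum>v\<in>words A n. word_prob b v * f v)" .
qed

lemma sum_word_prob:
  assumes "labelling M A b"
  shows "(\<Sum>v\<in>words A n. word_prob b v) = 1"
  using expectation_itinerary(2)[OF assms, of "\<lambda>_. 1" n] by (simp add: prob_space)

lemma word_prob_nonneg: "word_prob b v \<ge> 0" and word_prob_le_1: "word_prob b v \<le> 1"
  by (auto simp: word_prob_def)

definition label_entropy :: "'b set \<Rightarrow> ('a \<Rightarrow> 'b) \<Rightarrow> nat \<Rightarrow> real" where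
  "label_entropy A b n = - (\<Sum>v\<in>words A n. word_prob b v * ln (word_prob b v))"

lemma label_entropy_nonneg: "label_entropy A b n \<ge> 0"
proof -
  have "word_prob b v * ln (word_prob b v) \<le> 0" for v
    using word_prob_nonneg[of b v] word_prob_le_1[of b v]
    by (cases "word_prob b v = 0") (auto simp: mult_le_0_iff)
  then show ?thesis unfolding label_entropy_def by (simp add: sum_nonpos)
qed

lemma static_entropy_label_partition:
  assumes "labelling M A b"
  shows "static_entropy M (iterated_cover M T (label_partition M A b) n) = label_entropy A b n"
proof -
  let ?c = "\<lambda>v. {x \<in> space M. itinerary T b n x = v}"
  have *: "{x \<in> space M. follows T x (map (\<lambda>a. {y \<in> space M. b y = a}) v)} = ?c v"
    if "v \<in> words A n" for v
    using that T_power_space by (auto simp: follows_iff_itinerary words_def)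
  have "iterated_cover M T (label_partition M A b) n = ?c ` words A n"
    unfolding iterated_cover_eq label_partition_def words_image image_image
    using * by (rule image_cong[OF refl])
  moreover have "(\<Sum>B\<in>?c ` words A n. prob B * ln (prob B)) =
      (\<Sum>v\<in>words A n. prob (?c v) * ln (prob (?c v)))"
  proof (subst sum.reindex_nontrivial)
    show "finite (words A n)" using assms by (simp add: labelling_def finite_words)
    fix v w assume "v \<noteq> w" "?c v = ?c w"
    then have "?c v = {}" by auto
    then show "prob (?c v) * ln (prob (?c v)) = 0" by (simp only: measure_empty)
  qed simp
  ultimately show ?thesis
    unfolding static_entropy_def label_entropy_def word_prob_def
    by (auto simp: words_def intro!: sum.cong)
qed

text \<open>Gibbs' inequality, from \<open>ln t \<le> t - 1\<close>, for a weight \<open>q\<close> of total mass at most \<open>1\<close>.\<close>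
lemma label_entropy_le:
  fixes q :: "'b list \<Rightarrow> real"
  assumes b: "labelling M A b"
    and q: "\<And>v. v \<in> words A n \<Longrightarrow> word_prob b v > 0 \<Longrightarrow> q v > 0"
      "\<And>v. q v \<ge> 0" "(\<Sum>v\<in>words A n. q v) \<le> 1"
  shows "label_entropy A b n \<le> - (\<Sum>v\<in>words A n. word_prob b v * ln (q v))"
proof -
  have "word_prob b v * ln (q v) - word_prob b v * ln (word_prob b v) \<le> q v - word_prob b v"
    if "v \<in> words A n" for v
  proof (cases "word_prob b v = 0")
    case False
    then have p: "word_prob b v > 0" using word_prob_nonneg[of b v] by simp
    then have "word_prob b v * ln (q v / word_prob b v) \<le> word_prob b v * (q v / word_prob b v - 1)"
      using q(1)[OF that p] by (intro mult_left_mono ln_le_minus_one) auto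
    then show ?thesis using p q(1)[OF that p] by (simp add: ln_div algebra_simps)
  qed (use q in auto)
  then have "(\<Sum>v\<in>words A n. word_prob b v * ln (q v) - word_prob b v * ln (word_prob b v))
      \<le> (\<Sum>v\<in>words A n. q v - word_prob b v)" by (rule sum_mono)
  also have "\<dots> \<le> 0" using q(3) sum_word_prob[OF b] by (simp add: sum_subtractf)
  finally show ?thesis unfolding label_entropy_def by (simp add: sum_subtractf)
qed

lemma word_prob_append_marginals:
  assumes "labelling M A b"
  shows "u \<in> words A m \<Longrightarrow> (\<Sum>v\<in>words A n. word_prob b (u @ v)) = word_prob b u"
    and "v \<in> words A n \<Longrightarrow> (\<Sum>u\<in>words A m. word_prob b (u @ v)) = word_prob b v"
proof -
  have meas: "{x \<in> space M. itinerary T b k x = w} \<in> sets M" for k w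
    using assms by (intro itinerary_measurable) (simp add: labelling_def)
  have fin: "finite (words A k)" for k using assms by (simp add: labelling_def finite_words)
  let ?c = "\<lambda>w. {x \<in> space M. itinerary T b (length w) x = w}"
  show "(\<Sum>v\<in>words A n. word_prob b (u @ v)) = word_prob b u" if u: "u \<in> words A m"
  proof -
    have "?c u = (\<Union>v\<in>words A n. ?c (u @ v))"
      using u itinerary_in_words[OF assms] T_power_space
      by (auto simp: words_def itinerary_append)
    then have "prob (?c u) = (\<Sum>v\<in>words A n. prob (?c (u @ v)))"
      using meas fin
      by (simp only:, intro finite_measure_finite_Union)
         (auto simp: disjoint_family_on_def words_def)
    then show ?thesis by (simp add: word_prob_def)
  qed
  show "(\<Sum>u\<in>words A m. word_prob b (u @ v)) = word_prob b v" if v: "v \<in> words A n"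
  proof -
    have "(T ^^ m) -` ?c v \<inter> space M = (\<Union>u\<in>words A m. ?c (u @ v))"
      using v itinerary_in_words[OF assms, of _ m] T_power_space
      by (auto simp: words_def itinerary_append)
    then have "prob ((T ^^ m) -` ?c v \<inter> space M) = (\<Sum>u\<in>words A m. prob (?c (u @ v)))"
      using meas fin
      by (simp only:, intro finite_measure_finite_Union)
         (auto simp: disjoint_family_on_def words_def)
    then show ?thesis
      unfolding prob_vimage_T_power[OF meas[of "length v" v], of m] by (simp add: word_prob_def)
  qed
qed

text \<open>
  Compare the distribution of itineraries of length \<open>m + n\<close> with the product of the distributions
  for the lengths \<open>m\<close> and \<open>n\<close>. By invariance of the measure these are its two marginals.
\<close>
lemma label_entropy_subadditive:
  assumes "labelling M A b"
  shows "label_entropy A b (m + n) \<le> label_entropy A b m + label_entropy A b n"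
proof -
  let ?p = "word_prob b"
  define q where "q w = ?p (take m w) * ?p (drop m w)" for w
  have q: "q (u @ v) = ?p u * ?p v" if "u \<in> words A m" for u v
    using that by (simp add: q_def words_def)
  \<comment> \<open>Needed for absolute continuity: the product charges every word that has positive probability.\<close>
  have marg: "?p (u @ v) \<le> ?p u" "?p (u @ v) \<le> ?p v" if "u \<in> words A m" "v \<in> words A n" for u v
  proof -
    have fin: "finite (words A k)" for k using assms by (simp add: labelling_def finite_words)
    show "?p (u @ v) \<le> ?p u"
      unfolding word_prob_append_marginals(1)[OF assms that(1), of n, symmetric]
      using that fin by (intro member_le_sum) (auto simp: word_prob_nonneg)
    show "?p (u @ v) \<le> ?p v"
      unfolding word_prob_append_marginals(2)[OF assms that(2), of m, symmetric]
      using that fin by (intro member_le_sum[where f = "\<lambda>u. ?p (u @ v)"]) (auto simp: word_prob_nonneg)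
  qed
  have "label_entropy A b (m + n) \<le> - (\<Sum>w\<in>words A (m + n). ?p w * ln (q w))"
  proof (rule label_entropy_le[OF assms])
    fix w assume "w \<in> words A (m + n)" "?p w > 0"
    then obtain u v where "w = u @ v" "u \<in> words A m" "v \<in> words A n" "?p (u @ v) > 0"
      by (auto simp: words_append)
    then show "q w > 0" using marg[of u v] q by fastforce
  next
    show "q w \<ge> 0" for w by (simp add: q_def word_prob_nonneg)
    have "(\<Sum>w\<in>words A (m + n). q w) = (\<Sum>u\<in>words A m. ?p u * (\<Sum>v\<in>words A n. ?p v))"
      unfolding sum_words_append by (simp add: q sum_distrib_left)
    then show "(\<Sum>w\<in>words A (m + n). q w) \<le> 1" by (simp add: sum_word_prob[OF assms])
  qed
  also have "(\<Sum>w\<in>words A (m + n). ?p w * ln (q w)) =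
      (\<Sum>u\<in>words A m. \<Sum>v\<in>words A n. ?p (u @ v) * ln (?p u) + ?p (u @ v) * ln (?p v))"
    unfolding sum_words_append
  proof (intro sum.cong refl)
    fix u v assume uv: "u \<in> words A m" "v \<in> words A n"
    show "?p (u @ v) * ln (q (u @ v)) = ?p (u @ v) * ln (?p u) + ?p (u @ v) * ln (?p v)"
    proof (cases "?p (u @ v) = 0")
      case False
      then have "?p (u @ v) > 0" using word_prob_nonneg[of b "u @ v"] by simp
      then have "?p u > 0" "?p v > 0" using marg[OF uv] by linarith+
      then show ?thesis using q[OF uv(1)] by (simp add: ln_mult algebra_simps)
    qed simp
  qed
  also have "\<dots> = (\<Sum>u\<in>words A m. (\<Sum>v\<in>words A n. ?p (u @ v)) * ln (?p u))
      + (\<Sum>v\<in>words A n. (\<Sum>u\<in>words A m. ?p (u @ v)) * ln (?p v))"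
    unfolding sum.distrib sum_distrib_right by (subst (3) sum.swap) simp
  also have "- \<dots> = label_entropy A b m + label_entropy A b n"
    unfolding label_entropy_def by (simp add: word_prob_append_marginals[OF assms])
  finally show ?thesis .
qed

lemma partition_entropy_limit:
  assumes "labelling M A b"
  shows "(\<lambda>n. label_entropy A b n / n) \<longlonglongrightarrow> partition_entropy M T (label_partition M A b)"
  unfolding partition_entropy_def static_entropy_label_partition[OF assms]
  by (intro convergent_LIMSEQ_iff[THEN iffD1] subadditive_convergent label_entropy_nonneg
      label_entropy_subadditive[OF assms])

end

section \<open>Covering numbers\<close>

lemma measurable_selection:
  assumes "finite I" "\<And>i. i \<in> I \<Longrightarrow> A i \<in> sets M"
  obtains g where "g \<in> measurable M (count_space UNIV)"
    "\<And>x. x \<in> (\<Union>i\<in>I. A i) \<Longrightarrow> g x \<in> I \<and> x \<in> A (g x)"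
    "\<And>x. x \<notin> (\<Union>i\<in>I. A i) \<Longrightarrow> g x = d"
proof -
  have "\<exists>g. g \<in> measurable M (count_space UNIV) \<and>
      (\<forall>x. x \<in> (\<Union>i\<in>I. A i) \<longrightarrow> g x \<in> I \<and> x \<in> A (g x)) \<and>
      (\<forall>x. x \<notin> (\<Union>i\<in>I. A i) \<longrightarrow> g x = d)"
    using assms
  proof (induction I rule: finite_induct)
    case empty
    show ?case by (intro exI[of _ "\<lambda>_. d"]) auto
  next
    case (insert i I)
    then obtain g where g: "g \<in> measurable M (count_space UNIV)"
      "\<forall>x. x \<in> (\<Union>i\<in>I. A i) \<longrightarrow> g x \<in> I \<and> x \<in> A (g x)"
      "\<forall>x. x \<notin> (\<Union>i\<in>I. A i) \<longrightarrow> g x = d"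
      by auto
    have "{x \<in> space M. x \<in> A i} = A i" using sets.sets_into_space insert.prems by blast
    then have "(\<lambda>x. if x \<in> A i then i else g x) \<in> measurable M (count_space UNIV)"
      using g(1) insert.prems by (intro measurable_If) auto
    then show ?case
      using g(2,3) by (intro exI[of _ "\<lambda>x. if x \<in> A i then i else g x"]) auto
  qed
  then show thesis using that by blast
qed

lemma cover_labelling:
  assumes "is_cover M U"
  obtains b where "labelling M U b" "\<And>x. x \<in> space M \<Longrightarrow> x \<in> b x"
proof -
  have U: "finite U" "\<And>A. A \<in> U \<Longrightarrow> A \<in> sets M" "\<Union>U = space M"
    using assms by (auto simp: is_cover_def)
  obtain b where "b \<in> measurable M (count_space UNIV)" "\<And>x. x \<in> (\<Union>A\<in>U. A) \<Longrightarrow> b x \<in> U \<and> x \<in> b x"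
    using measurable_selection[of U "\<lambda>A. A" M] U by metis
  then show thesis using U that[of b] by (auto simp: labelling_def)
qed

context measure_dynamical_system
begin

lemma follows_itinerary:
  assumes "x \<in> space M" "\<And>y. y \<in> space M \<Longrightarrow> y \<in> c (b y)"
  shows "follows T x (map c (itinerary T b n x))"
  using assms T_power_space[OF assms(1)] by (simp add: follows_def nth_itinerary)

lemma cover_number_le:
  assumes "finite K" "K \<subseteq> words U n"
    and "prob {x \<in> space M. \<not> (\<exists>v\<in>K. follows T x v)} < \<epsilon>"
  shows "cover_number M (iterated_cover M T U n) \<epsilon> \<le> card K"
proof -
  let ?W = "(\<lambda>v. {x \<in> space M. follows T x v}) ` K"
  have eq: "space M - \<Union>?W = {x \<in> space M. \<not> (\<exists>v\<in>K. follows T x v)}" by auto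
  have "cover_number M (iterated_cover M T U n) \<epsilon> \<le> card ?W"
    unfolding cover_number_def
    by (rule Least_le, rule exI[of _ ?W], unfold iterated_cover_eq eq)
       (use assms in \<open>auto intro: image_mono\<close>)
  also have "\<dots> \<le> card K" using assms by (intro card_image_le)
  finally show ?thesis .
qed

lemma cover_number_witness:
  assumes "is_cover M U" "\<epsilon> > 0"
  obtains K where "K \<subseteq> words U n" "card K = cover_number M (iterated_cover M T U n) \<epsilon>"
    "prob {x \<in> space M. \<not> (\<exists>v\<in>K. follows T x v)} < \<epsilon>"
proof -
  define c where "c v = {x \<in> space M. follows T x v}" for v
  define P where "P k \<longleftrightarrow> (\<exists>W\<subseteq>c ` words U n. finite W \<and> card W = k \<and> prob (space M - \<Union>W) < \<epsilon>)" for k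
  have fin: "finite (words U n)" using assms by (simp add: is_cover_def finite_words)
  obtain b where b: "labelling M U b" "\<And>x. x \<in> space M \<Longrightarrow> x \<in> b x"
    using cover_labelling[OF assms(1)] by blast
  have "x \<in> \<Union>(c ` words U n)" if "x \<in> space M" for x
    using follows_itinerary[of x id b n] b that itinerary_in_words[OF b(1) that, of n]
    by (auto simp: c_def)
  then have empty: "space M - \<Union>(c ` words U n) = {}" by blast
  have "P (card (c ` words U n))"
    unfolding P_def by (rule exI[of _ "c ` words U n"]) (use fin assms in \<open>simp add: empty\<close>)
  then have "P (LEAST k. P k)" by (rule LeastI)
  moreover have "cover_number M (iterated_cover M T U n) \<epsilon> = (LEAST k. P k)"
    unfolding cover_number_def iterated_cover_eq P_def c_def by (rule refl)
  ultimately have "P (cover_number M (iterated_cover M T U n) \<epsilon>)" by (simp only:)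
  then obtain W where W: "W \<subseteq> c ` words U n"
    "card W = cover_number M (iterated_cover M T U n) \<epsilon>" "prob (space M - \<Union>W) < \<epsilon>"
    unfolding P_def by blast
  obtain K where K: "K \<subseteq> words U n" "inj_on c K" "W = c ` K"
    using W(1) unfolding subset_image_inj by blast
  have *: "space M - \<Union>(c ` K) = {x \<in> space M. \<not> (\<exists>v\<in>K. follows T x v)}"
    by (auto simp: c_def)
  show thesis
  proof (rule that[OF K(1)])
    show "card K = cover_number M (iterated_cover M T U n) \<epsilon>"
      using W(2) card_image[OF K(2)] K(3) by simp
    show "prob {x \<in> space M. \<not> (\<exists>v\<in>K. follows T x v)} < \<epsilon>"
      using W(3) unfolding K(3) * .
  qed
qed

lemma cover_number_ge_1:
  assumes "is_cover M U" "0 < \<epsilon>" "\<epsilon> \<le> 1"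
  shows "cover_number M (iterated_cover M T U n) \<epsilon> \<ge> 1"
proof (rule ccontr)
  obtain K where K: "K \<subseteq> words U n" "card K = cover_number M (iterated_cover M T U n) \<epsilon>"
    "prob {x \<in> space M. \<not> (\<exists>v\<in>K. follows T x v)} < \<epsilon>"
    by (rule cover_number_witness[OF assms(1,2), of n])
  have "finite K" using K(1) assms by (auto simp: is_cover_def intro: finite_subset finite_words)
  moreover assume "\<not> ?thesis"
  then have "card K = 0" using K(2) by linarith
  ultimately have "K = {}" by simp
  then show False using K(3) assms by (simp add: prob_space)
qed

lemma prob_itinerary_in:
  assumes "labelling M A b" "K \<subseteq> words A n"
  shows "prob {x \<in> space M. itinerary T b n x \<in> K} = (\<Sum>v\<in>K. word_prob b v)"
proof -
  have fin: "finite K"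
    using assms by (auto simp: labelling_def intro: finite_subset finite_words)
  have meas: "{x \<in> space M. itinerary T b k x = w} \<in> sets M" for k w
    using assms by (intro itinerary_measurable) (simp add: labelling_def)
  have "{x \<in> space M. itinerary T b n x \<in> K} =
      (\<Union>v\<in>K. {x \<in> space M. itinerary T b n x = v})" by auto
  then have "prob {x \<in> space M. itinerary T b n x \<in> K} =
      (\<Sum>v\<in>K. prob {x \<in> space M. itinerary T b n x = v})"
    using meas fin
    by (simp only:, intro finite_measure_finite_Union) (auto simp: disjoint_family_on_def)
  also have "\<dots> = (\<Sum>v\<in>K. word_prob b v)"
    using assms(2) by (intro sum.cong) (auto simp: word_prob_def words_def)
  finally show ?thesis .
qed

text \<open>
  A labelling finer than \<open>U\<close>, with \<open>c\<close> choosing the element of \<open>U\<close> around each label, translates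
  itineraries into words over \<open>U\<close> that the orbits follow. So a set of itineraries that carries almost
  all the mass yields an efficient subcover.
\<close>
lemma cover_number_le_itinerary:
  assumes b: "labelling M A b" and c: "c ` A \<subseteq> U" "\<And>x. x \<in> space M \<Longrightarrow> x \<in> c (b x)"
    and K: "K \<subseteq> words A n" "(\<Sum>v\<in>words A n - K. word_prob b v) < \<epsilon>"
  shows "cover_number M (iterated_cover M T U n) \<epsilon> \<le> card K"
proof -
  have fin: "finite K"
    using b K by (auto simp: labelling_def intro: finite_subset finite_words)
  have "{x \<in> space M. \<not> (\<exists>v\<in>map c ` K. follows T x v)} \<subseteq>
      {x \<in> space M. itinerary T b n x \<in> words A n - K}"
    using follows_itinerary[where b = b and c = c] c(2) itinerary_in_words[OF b] by auto
  moreover have "{x \<in> space M. itinerary T b n x \<in> words A n - K} \<in> sets M"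
  proof -
    have "{x \<in> space M. itinerary T b n x \<in> words A n - K} =
      (\<Union>v\<in>words A n - K. {x \<in> space M. itinerary T b n x = v})" by auto
    also have "\<dots> \<in> sets M"
      using b finite_words[of A n]
      by (intro sets.finite_UN itinerary_measurable) (auto simp: labelling_def)
    finally show ?thesis .
  qed
  ultimately have "prob {x \<in> space M. \<not> (\<exists>v\<in>map c ` K. follows T x v)} \<le>
      prob {x \<in> space M. itinerary T b n x \<in> words A n - K}"
    by (intro finite_measure_mono)
  also have "\<dots> < \<epsilon>" using prob_itinerary_in[OF b, of "words A n - K" n] K(2) by simp
  finally have "prob {x \<in> space M. \<not> (\<exists>v\<in>map c ` K. follows T x v)} < \<epsilon>" .
  moreover have "map c ` K \<subseteq> words U n" using K(1) c(1) unfolding words_def by fastforce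
  ultimately have "cover_number M (iterated_cover M T U n) \<epsilon> \<le> card (map c ` K)"
    using fin by (intro cover_number_le) auto
  also have "\<dots> \<le> card K" using fin by (rule card_image_le)
  finally show ?thesis .
qed

text \<open>
  The information \<open>- ln (word_prob b v)\<close> has expectation \<open>label_entropy A b n \<le> n * h1\<close>. By Markov's
  inequality it exceeds \<open>n * h0\<close> with probability at most \<open>h1 / h0\<close>, and at most \<open>exp (n * h0)\<close>
  words have smaller information.
\<close>
lemma cover_number_le_exp_entropy:
  assumes b: "labelling M A b" and c: "c ` A \<subseteq> U" "\<And>x. x \<in> space M \<Longrightarrow> x \<in> c (b x)"
    and h: "label_entropy A b n \<le> n * h1" "h0 > 0" "h1 / h0 < \<epsilon>" and n: "n \<ge> 1"
  shows "cover_number M (iterated_cover M T U n) \<epsilon> \<le> exp (n * h0)"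
proof -
  let ?p = "word_prob b"
  define K where "K = {v \<in> words A n. ?p v \<ge> exp (- (n * h0))}"
  have fin: "finite (words A n)" using b by (simp add: labelling_def finite_words)
  have "n * h0 * (\<Sum>v\<in>words A n - K. ?p v) \<le> (\<Sum>v\<in>words A n - K. - (?p v * ln (?p v)))"
    unfolding sum_distrib_left
  proof (rule sum_mono)
    fix v assume v: "v \<in> words A n - K"
    show "n * h0 * ?p v \<le> - (?p v * ln (?p v))"
    proof (cases "?p v = 0")
      case False
      then have p: "?p v > 0" using word_prob_nonneg[of b v] by simp
      have "ln (?p v) \<le> - (n * h0)"
        using v p ln_mono[of "?p v" "exp (- (n * h0))"] by (auto simp: K_def)
      then have "?p v * ln (?p v) \<le> ?p v * - (n * h0)" using p by (intro mult_left_mono) auto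
      then show ?thesis by (simp add: mult_ac)
    qed simp
  qed
  also have "\<dots> \<le> (\<Sum>v\<in>words A n. - (?p v * ln (?p v)))"
    using fin
  proof (intro sum_mono2)
    fix v
    show "0 \<le> - (?p v * ln (?p v))"
      using word_prob_nonneg[of b v] word_prob_le_1[of b v]
      by (cases "?p v = 0") (auto simp: mult_le_0_iff)
  qed auto
  also have "\<dots> = label_entropy A b n" by (simp add: label_entropy_def sum_negf)
  also have "\<dots> \<le> n * h1" by (rule h)
  finally have "h0 * (\<Sum>v\<in>words A n - K. ?p v) \<le> h1" using n by (simp add: mult.assoc)
  then have "(\<Sum>v\<in>words A n - K. ?p v) \<le> h1 / h0" using h(2) by (simp add: field_simps)
  then have "(\<Sum>v\<in>words A n - K. ?p v) < \<epsilon>" using h(3) by simp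
  then have "cover_number M (iterated_cover M T U n) \<epsilon> \<le> card K"
    by (intro cover_number_le_itinerary[OF b c]) (auto simp: K_def)
  moreover have "real (card K) \<le> exp (n * h0)"
  proof -
    have "card K * exp (- (n * h0)) = (\<Sum>v\<in>K. exp (- (n * h0)))" by simp
    also have "\<dots> \<le> (\<Sum>v\<in>K. ?p v)" by (rule sum_mono) (auto simp: K_def)
    also have "\<dots> \<le> (\<Sum>v\<in>words A n. ?p v)"
      using fin by (intro sum_mono2) (auto simp: K_def word_prob_nonneg)
    also have "\<dots> = 1" by (rule sum_word_prob[OF b])
    finally show ?thesis by (simp add: exp_minus field_simps)
  qed
  ultimately show ?thesis by linarith
qed

end

section \<open>Long words along almost every orbit\<close>

text \<open>
  Almost every orbit eventually, say at time \<open>j\<close>, enters the set of points that are covered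
  efficiently for infinitely many lengths. Putting \<open>j\<close> arbitrary letters in front of an efficient
  word gives a word that the point itself follows. Up to measure \<open>\<delta>\<close> these delays are bounded by
  some \<open>J\<close>, so the delay multiplies the number of words of each length by a constant, which is
  absorbed by the gap between \<open>h\<close> and \<open>\<kappa>\<close> once the words are long enough.
\<close>
lemma (in ergodic_dynamical_system) exists_word_selector:
  fixes h \<kappa> :: real
  assumes U: "is_cover M U" and \<kappa>: "h < \<kappa>" "0 \<le> \<kappa>" and \<epsilon>: "0 < \<epsilon>" "\<epsilon> < 1" and "0 < \<delta>"
    and freq: "\<exists>\<^sub>\<infinity>n. cover_number M (iterated_cover M T U n) \<epsilon> \<le> exp (n * h)"
  obtains W \<omega> where "finite W" "[] \<notin> W" "\<And>w. w \<in> W \<Longrightarrow> set w \<subseteq> U"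
    "(\<Sum>w\<in>W. exp (- \<kappa> * length w)) \<le> 1/2"
    "\<omega> \<in> measurable M (count_space UNIV)"
    "\<And>x. x \<in> space M \<Longrightarrow> \<omega> x \<in> insert [] W \<and> follows T x (\<omega> x)"
    "prob {x \<in> space M. \<omega> x = []} < \<delta>"
proof -
  have finU: "finite U" and setsU: "U \<subseteq> sets M" using U by (auto simp: is_cover_def)
  define I where "I = {n. cover_number M (iterated_cover M T U n) \<epsilon> \<le> exp (n * h)}"
  have "\<exists>K. K \<subseteq> words U n \<and> card K = cover_number M (iterated_cover M T U n) \<epsilon> \<and>
      prob {x \<in> space M. \<not> (\<exists>v\<in>K. follows T x v)} < \<epsilon>" for n
    by (rule cover_number_witness[OF U \<epsilon>(1), of n]) blast
  then have "\<exists>K0. \<forall>n. K0 n \<subseteq> words U n \<and>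
      card (K0 n) = cover_number M (iterated_cover M T U n) \<epsilon> \<and>
      prob {x \<in> space M. \<not> (\<exists>v\<in>K0 n. follows T x v)} < \<epsilon>"
    by (intro choice allI)
  then obtain K0 where "\<forall>n. K0 n \<subseteq> words U n \<and>
      card (K0 n) = cover_number M (iterated_cover M T U n) \<epsilon> \<and>
      prob {x \<in> space M. \<not> (\<exists>v\<in>K0 n. follows T x v)} < \<epsilon>"
    by (rule exE)
  then have K0: "K0 n \<subseteq> words U n"
    "card (K0 n) = cover_number M (iterated_cover M T U n) \<epsilon>"
    "prob {x \<in> space M. \<not> (\<exists>v\<in>K0 n. follows T x v)} < \<epsilon>" for n
    by (simp_all only:)
  define K where "K n = (if n \<in> I then K0 n else {})" for n
  have K: "K n \<subseteq> words U n" "card (K n) \<le> exp (n * h)" "finite (K n)" for n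
    using K0[of n] finite_subset[OF K0(1) finite_words[OF finU]]
    by (auto simp: K_def I_def)
  define G where "G n = {x \<in> space M. \<exists>v\<in>K n. follows T x v}" for n
  have G_sets [measurable]: "G n \<in> sets M" for n
  proof -
    have "G n = (\<Union>v\<in>K n. {x \<in> space M. follows T x v})" unfolding G_def by auto
    also have "\<dots> \<in> sets M"
      using K[of n] setsU by (intro sets.finite_UN follows_measurable[of U]) (auto simp: words_def)
    finally show ?thesis .
  qed
  have G_prob: "prob (G n) \<ge> 1 - \<epsilon>" if "n \<in> I" for n
  proof -
    have "{x \<in> space M. \<not> (\<exists>v\<in>K0 n. follows T x v)} = space M - G n"
      using that by (auto simp: G_def K_def)
    then show ?thesis using K0(3)[of n] prob_compl[OF G_sets[of n]] by simp
  qed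
  define L where "L m = (\<Union>n\<in>{m..}. G n)" for m
  have L_sets [measurable]: "L m \<in> sets M" for m unfolding L_def by measurable
  have L_prob: "prob (L m) \<ge> 1 - \<epsilon>" for m
  proof -
    obtain n where "n \<ge> m" "n \<in> I"
      using freq unfolding I_def INFM_nat_le by blast
    then have "prob (G n) \<le> prob (L m)"
      unfolding L_def by (intro finite_measure_mono) auto
    then show ?thesis using G_prob[OF \<open>n \<in> I\<close>] by simp
  qed
  have "decseq L"
    unfolding decseq_def L_def by (intro allI impI UN_mono) auto
  then have "(\<lambda>m. prob (L m)) \<longlonglongrightarrow> prob (\<Inter>m. L m)"
    by (intro finite_Lim_measure_decseq) auto
  then have "prob (\<Inter>m. L m) \<ge> 1 - \<epsilon>"
    by (rule LIMSEQ_le_const) (use L_prob in blast)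
  then have "prob {x \<in> space M. \<exists>j. (T ^^ j) x \<in> (\<Inter>m. L m)} = 1"
    using \<epsilon> by (intro prob_hitting) auto
  \<comment> \<open>Almost every orbit enters \<open>Z\<close>; up to measure \<open>\<delta>\<close> it does so before time \<open>J\<close>.\<close>
  define Z where "Z = (\<Inter>m. L m)"
  have Z_sets [measurable]: "Z \<in> sets M" unfolding Z_def by measurable
  define F where "F J = {x \<in> space M. \<exists>j\<le>J. (T ^^ j) x \<in> Z}" for J
  have F_sets [measurable]: "F J \<in> sets M" for J unfolding F_def by measurable
  have "incseq F" unfolding incseq_def F_def by (blast intro: order_trans)
  then have "(\<lambda>J. prob (F J)) \<longlonglongrightarrow> prob (\<Union>J. F J)"
    by (intro finite_Lim_measure_incseq) auto
  also have "(\<Union>J. F J) = {x \<in> space M. \<exists>j. (T ^^ j) x \<in> Z}"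
    unfolding F_def by blast
  also have "prob \<dots> = 1" unfolding Z_def by fact
  finally have "\<forall>\<^sub>F J in sequentially. prob (F J) > 1 - \<delta>"
    using \<open>\<delta> > 0\<close> by (intro order_tendstoD(1)) auto
  then obtain J where J: "prob (F J) > 1 - \<delta>"
    using eventually_happens trivial_limit_sequentially by blast
  define A where "A = (\<Union>j\<le>J. words U j)"
  have finA: "finite A" unfolding A_def using finU by (simp add: finite_words)
  have "summable (\<lambda>n. card A * exp (- (\<kappa> - h)) ^ n)"
    using \<kappa> by (intro summable_mult summable_geometric) auto
  then obtain n0 where n0: "\<And>m n. m \<ge> n0 \<Longrightarrow> norm (\<Sum>k=m..<n. card A * exp (- (\<kappa> - h)) ^ k) < 1/2"
    unfolding summable_Cauchy by (meson half_gt_zero zero_less_one)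
  \<comment> \<open>The words have length at least \<open>m\<close>; the lower bound \<open>1\<close> keeps the empty word out of \<open>W\<close>.\<close>
  define m where "m = max 1 n0"
  define H where "H n = {x \<in> space M. \<exists>j\<le>J. \<exists>i\<in>{m..<n}. (T ^^ j) x \<in> G i}" for n
  have H_sets [measurable]: "H n \<in> sets M" for n unfolding H_def by measurable
  have "F J \<subseteq> (\<Union>n. H n)"
  proof
    fix x assume "x \<in> F J"
    then obtain j where j: "x \<in> space M" "j \<le> J" "(T ^^ j) x \<in> L m"
      unfolding F_def Z_def by blast
    then obtain i where "i \<ge> m" "(T ^^ j) x \<in> G i" unfolding L_def by auto
    then have "x \<in> H (Suc i)"
      using j unfolding H_def by (auto intro!: exI[of _ j] bexI[of _ i])
    then show "x \<in> (\<Union>n. H n)" by blast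
  qed
  then have "prob (F J) \<le> prob (\<Union>n. H n)" by (intro finite_measure_mono) auto
  then have "prob (\<Union>n. H n) > 1 - \<delta>" using J by simp
  moreover have "incseq H"
    unfolding incseq_def H_def by (fastforce intro: order_trans)
  then have "(\<lambda>n. prob (H n)) \<longlonglongrightarrow> prob (\<Union>n. H n)"
    by (intro finite_Lim_measure_incseq) auto
  ultimately have "\<forall>\<^sub>F n in sequentially. prob (H n) > 1 - \<delta>"
    by (intro order_tendstoD(1)) auto
  then obtain n where n: "prob (H n) > 1 - \<delta>"
    using eventually_happens trivial_limit_sequentially by blast
  define W where "W = (\<lambda>(i, u, v). u @ v) ` (SIGMA i:{m..<n}. A \<times> K i)"
  have finW: "finite W" unfolding W_def using finA K by (intro finite_imageI finite_SigmaI) auto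
  have W_words: "set w \<subseteq> U" if "w \<in> W" for w
    using that K(1) unfolding W_def A_def words_def by fastforce
  have Nil: "[] \<notin> W"
    using K(1) unfolding W_def m_def words_def by fastforce
  have sum: "(\<Sum>w\<in>W. exp (- \<kappa> * length w)) \<le> 1/2"
  proof -
    have "(\<Sum>w\<in>W. exp (- \<kappa> * length w)) \<le>
        (\<Sum>(i, u, v)\<in>(SIGMA i:{m..<n}. A \<times> K i). exp (- \<kappa> * length (u @ v)))"
      unfolding W_def using finA K
      by (intro order_trans[OF sum_image_le]) (auto simp: case_prod_beta)
    also have "\<dots> \<le> (\<Sum>(i, u, v)\<in>(SIGMA i:{m..<n}. A \<times> K i). exp (- \<kappa> * i))"
    proof -
      have "exp (- \<kappa> * length (u @ v)) \<le> exp (- \<kappa> * i)" if "v \<in> K i" for i u v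
      proof -
        have "length v = i" using K(1) that by (auto simp: words_def)
        then show ?thesis using \<kappa> by (auto intro!: mult_left_mono)
      qed
      then show ?thesis by (intro sum_mono) auto
    qed
    also have "\<dots> = (\<Sum>i\<in>{m..<n}. \<Sum>p\<in>A \<times> K i. exp (- \<kappa> * i))"
      using finA K by (subst sum.Sigma) (auto simp: case_prod_beta)
    also have "\<dots> = (\<Sum>i\<in>{m..<n}. card A * (card (K i) * exp (- \<kappa> * i)))"
      by (simp add: card_cartesian_product mult.assoc)
    also have "\<dots> \<le> (\<Sum>i\<in>{m..<n}. card A * (exp (i * h) * exp (- \<kappa> * i)))"
      using K(2) by (intro sum_mono mult_left_mono mult_right_mono) auto
    also have "\<dots> = (\<Sum>i\<in>{m..<n}. card A * exp (- (\<kappa> - h)) ^ i)"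
      by (intro sum.cong refl) (simp add: exp_of_nat_mult[symmetric] exp_add[symmetric] algebra_simps)
    also have "\<dots> \<le> 1/2" using n0[of m n] by (simp add: m_def)
    finally show ?thesis .
  qed
  obtain \<omega> where \<omega>: "\<omega> \<in> measurable M (count_space UNIV)"
    "\<And>x. x \<in> (\<Union>w\<in>W. {x \<in> space M. follows T x w}) \<Longrightarrow>
       \<omega> x \<in> W \<and> x \<in> {y \<in> space M. follows T y (\<omega> x)}"
    "\<And>x. x \<notin> (\<Union>w\<in>W. {x \<in> space M. follows T x w}) \<Longrightarrow> \<omega> x = []"
    using measurable_selection[OF finW, of "\<lambda>w. {x \<in> space M. follows T x w}" M "[]"]
      follows_measurable[OF setsU W_words] by auto
  have H_word: "\<omega> x \<noteq> []" if xH: "x \<in> H n" for x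
  proof -
    obtain j i v where x: "x \<in> space M" and j: "j \<le> J" and i: "i \<in> {m..<n}"
      and v: "v \<in> K i" "follows T ((T ^^ j) x) v"
      using xH unfolding H_def G_def by blast
    obtain b where b: "labelling M U b" "\<And>x. x \<in> space M \<Longrightarrow> x \<in> b x"
      using cover_labelling[OF U] by blast
    define u where "u = itinerary T b j x"
    have "follows T x u" using follows_itinerary[OF x, of id b j] b by (simp add: u_def)
    then have "follows T x (u @ v)" using v by (simp add: follows_append u_def)
    moreover have "u \<in> A" using itinerary_in_words[OF b(1) x, of j] j by (auto simp: A_def u_def)
    ultimately have "\<omega> x \<in> W"
      using x v i \<omega>(2)[of x] unfolding W_def by force
    then show ?thesis using Nil by auto
  qed
  have "prob {x \<in> space M. \<omega> x = []} \<le> prob (space M - H n)"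
    using H_word by (intro finite_measure_mono) auto
  also have "\<dots> < \<delta>" using n prob_compl[OF H_sets[of n]] by simp
  finally have "prob {x \<in> space M. \<omega> x = []} < \<delta>" .
  moreover have "\<omega> x \<in> insert [] W \<and> follows T x (\<omega> x)" if "x \<in> space M" for x
    using \<omega>(2,3)[of x] by (cases "x \<in> (\<Union>w\<in>W. {x \<in> space M. follows T x w})") auto
  ultimately show thesis using that[OF finW Nil W_words sum \<omega>(1)] by blast
qed

section \<open>Scanning orbits\<close>

text \<open>
  Starting at \<open>y\<close>, the orbit is cut into the words that \<open>\<omega>\<close> proposes. The state at time \<open>r\<close> is
  what is left of the current word, beginning with the letter for time \<open>r\<close>; when this was the last
  letter, or when \<open>\<omega>\<close> had nothing to propose, the next word is taken from \<open>\<omega>\<close>.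
\<close>
primrec scan_state :: "('a \<Rightarrow> 'a) \<Rightarrow> ('a \<Rightarrow> 'b list) \<Rightarrow> nat \<Rightarrow> 'a \<Rightarrow> 'b list" where
  "scan_state T \<omega> 0 y = \<omega> y"
| "scan_state T \<omega> (Suc r) y =
     (if length (scan_state T \<omega> r y) \<le> 1 then \<omega> ((T ^^ Suc r) y) else tl (scan_state T \<omega> r y))"

context measure_dynamical_system
begin

text \<open>
  A scan needs a starting point that all points of an orbit segment agree on. It is the latest
  visit to \<open>B\<close> in the past, where \<open>S\<close> inverts \<open>T\<close>.
\<close>
definition visit_age :: "'a set \<Rightarrow> 'a \<Rightarrow> nat" where
  "visit_age B x = (LEAST r. (S ^^ r) x \<in> B)"

definition pending_word :: "('a \<Rightarrow> 'b list) \<Rightarrow> 'a set \<Rightarrow> 'a \<Rightarrow> 'b list" where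
  "pending_word \<omega> B x =
     (if \<exists>r. (S ^^ r) x \<in> B then scan_state T \<omega> (visit_age B x) ((S ^^ visit_age B x) x) else [])"

lemma pending_word_at_visit: "x \<in> B \<Longrightarrow> pending_word \<omega> B x = \<omega> x"
proof -
  assume "x \<in> B"
  then have "visit_age B x = 0" unfolding visit_age_def by (intro Least_eq_0) simp
  moreover have "\<exists>r. (S ^^ r) x \<in> B" using \<open>x \<in> B\<close> by (intro exI[of _ 0]) simp
  ultimately show ?thesis by (simp add: pending_word_def)
qed

text \<open>Scanning is consistent along orbits, because \<open>T x\<close> and \<open>x\<close> have the same latest visit unless \<open>T x\<close> is in \<open>B\<close>.\<close>
lemma pending_word_step:
  assumes x: "x \<in> space M" and past: "\<exists>r. (S ^^ r) x \<in> B"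
  shows "pending_word \<omega> B (T x) =
    (if T x \<in> B \<or> length (pending_word \<omega> B x) \<le> 1 then \<omega> (T x) else tl (pending_word \<omega> B x))"
proof (cases "T x \<in> B")
  case True
  then show ?thesis by (simp add: pending_word_at_visit)
next
  case False
  let ?r = "visit_age B x"
  have shift: "(S ^^ Suc r) (T x) = (S ^^ r) x" for r
    using x by (simp only: funpow_Suc_right comp_apply S_T)
  obtain r where r: "(S ^^ r) x \<in> B" using past by blast
  have age: "visit_age B (T x) = Suc ?r"
    unfolding visit_age_def
    by (subst Least_Suc[of _ "Suc r"]) (use r False in \<open>simp_all only: shift, simp\<close>)
  have "\<exists>r. (S ^^ r) (T x) \<in> B" using r shift by metis
  then have "pending_word \<omega> B (T x) = scan_state T \<omega> (Suc ?r) ((S ^^ ?r) x)"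
    unfolding pending_word_def age shift by simp
  moreover have "pending_word \<omega> B x = scan_state T \<omega> ?r ((S ^^ ?r) x)"
    using past by (simp add: pending_word_def)
  moreover have "(T ^^ Suc ?r) ((S ^^ ?r) x) = T x"
    using T_power_S_power[OF x, of ?r] by simp
  ultimately show ?thesis using False by (simp del: funpow.simps)
qed

lemma pending_word_measurable:
  assumes [measurable]: "\<omega> \<in> measurable M (count_space UNIV)" "B \<in> sets M"
  shows "pending_word \<omega> B \<in> measurable M (count_space UNIV)"
proof -
  interpret S: measure_dynamical_system M S by (rule inverse_system)
  have scan: "scan_state T \<omega> r \<in> measurable M (count_space UNIV)" for r
  proof (induction r)
    case (Suc r)
    have "{x \<in> space M. length (scan_state T \<omega> r x) \<le> 1} \<in> sets M"
      using Suc by measurable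
    moreover have "(\<lambda>y. \<omega> ((T ^^ Suc r) y)) \<in> measurable M (count_space UNIV)" by measurable
    moreover have "(\<lambda>y. tl (scan_state T \<omega> r y)) \<in> measurable M (count_space UNIV)"
      using Suc by (rule measurable_compose) simp
    ultimately show ?case unfolding scan_state.simps by (intro measurable_If)
  qed simp
  have [measurable]: "visit_age B \<in> measurable M (count_space UNIV)"
    unfolding visit_age_def by measurable
  have "(\<lambda>x. scan_state T \<omega> (visit_age B x) ((S ^^ visit_age B x) x)) \<in> measurable M (count_space UNIV)"
    by (rule measurable_compose_countable[where f = "\<lambda>r x. scan_state T \<omega> r ((S ^^ r) x)"])
       (auto intro!: measurable_compose[OF S.T_power_measurable scan])
  moreover have "{x \<in> space M. \<exists>r. (S ^^ r) x \<in> B} \<in> sets M" by measurable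
  ultimately show ?thesis unfolding pending_word_def by (intro measurable_If) auto
qed

lemma pending_word_invariant:
  assumes x: "x \<in> space M"
    and I: "\<And>y. y \<in> space M \<Longrightarrow> I y (\<omega> y)" "\<And>y. I y []"
      "\<And>y w. y \<in> space M \<Longrightarrow> I y w \<Longrightarrow> length w > 1 \<Longrightarrow> I (T y) (tl w)"
  shows "I x (pending_word \<omega> B x)"
proof -
  interpret S: measure_dynamical_system M S by (rule inverse_system)
  have scan: "I ((T ^^ r) y) (scan_state T \<omega> r y)" if y: "y \<in> space M" for r y
  proof (induction r)
    case (Suc r)
    then show ?case using I T_power_space[OF y, of r] T_power_space[OF y, of "Suc r"] by auto
  qed (use I y in simp)
  then show ?thesis
    using scan[of "(S ^^ visit_age B x) x" "visit_age B x"] S.T_power_space[OF x] T_power_S_power[OF x] I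
    by (auto simp: pending_word_def)
qed

end

lemma (in ergodic_dynamical_system) prob_past_visit:
  assumes "B \<in> sets M" "prob B > 0"
  shows "prob {x \<in> space M. \<exists>r. (S ^^ r) x \<in> B} = 1"
  using ergodic_dynamical_system.prob_hitting[OF inverse_ergodic assms] .

definition visits :: "('a \<Rightarrow> 'a) \<Rightarrow> 'a set \<Rightarrow> nat \<Rightarrow> 'a \<Rightarrow> real" where
  "visits T R n x = (\<Sum>j<n. indicator R ((T ^^ j) x))"

lemma visits_nonneg: "visits T R n x \<ge> 0"
  by (simp add: visits_def sum_nonneg)

lemma visits_add: "visits T R (m + n) x = visits T R m x + visits T R n ((T ^^ m) x)"
proof (induction n)
  case (Suc n)
  have "(T ^^ n) ((T ^^ m) x) = (T ^^ (m + n)) x"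
    by (simp add: funpow_add[of n m] add.commute[of m])
  then show ?case using Suc by (simp add: visits_def)
qed (simp add: visits_def)

text \<open>
  What the scan means for the weight of an itinerary. Here \<open>\<sigma>\<close> is the state of the scan, \<open>b\<close> reads
  off its first letter, and \<open>q\<close> loses at most the factor \<open>exp (- c)\<close> when such a letter is put in
  front of a word, and at most \<open>exp (- \<kappa> * length w)\<close> when \<open>w\<close> in \<open>W\<close> is. The forward invariant set
  \<open>X\<close>, on which the rule of the scan holds, will be the set of points that come from \<open>B\<close>.
\<close>

locale scanned_orbit =
  fixes T :: "'a \<Rightarrow> 'a" and X :: "'a set" and B :: "'a set" and L :: nat
    and W :: "'b list set" and \<omega> \<sigma> :: "'a \<Rightarrow> 'b list" and b :: "'a \<Rightarrow> 'b"
    and q :: "'b list \<Rightarrow> real" and c \<kappa> :: real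
  assumes X: "\<And>x. x \<in> X \<Longrightarrow> T x \<in> X"
    and \<sigma>: "\<And>x. x \<in> X \<Longrightarrow> \<sigma> (T x) = (if T x \<in> B \<or> length (\<sigma> x) \<le> 1 then \<omega> (T x) else tl (\<sigma> x))"
    and \<omega>: "\<And>x. x \<in> X \<Longrightarrow> \<omega> x \<in> insert [] W"
    and b: "\<And>x. x \<in> X \<Longrightarrow> \<sigma> x \<noteq> [] \<Longrightarrow> b x = hd (\<sigma> x)"
    and L: "\<And>w. w \<in> W \<Longrightarrow> length w \<le> L" "L \<ge> 1"
    and \<sigma>L: "\<And>x. x \<in> X \<Longrightarrow> length (\<sigma> x) \<le> L"
    and Nil: "[] \<notin> W"
    and c: "c \<ge> 0" and \<kappa>: "\<kappa> \<ge> 0"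
    and q_nonneg: "\<And>v. q v \<ge> 0" and q_Nil: "q [] = 1"
    and q_Cons: "\<And>x v. x \<in> X \<Longrightarrow> q (b x # v) \<ge> exp (- c) * q v"
    and q_append: "\<And>w v. w \<in> W \<Longrightarrow> q (w @ v) \<ge> exp (- \<kappa> * length w) * q v"
begin

text \<open>
  Outside \<open>R\<close> a letter belongs to a word that the scan completes: \<open>\<omega>\<close> proposes something, and no
  visit to \<open>B\<close> within the maximal word length \<open>L\<close> interrupts the scan.
\<close>
definition R :: "'a set" where
  "R = {x. \<omega> x = [] \<or> (\<exists>j\<in>{1..L}. (T ^^ j) x \<in> B)}"

lemma X_power: "x \<in> X \<Longrightarrow> (T ^^ n) x \<in> X"
  by (induction n) (auto simp: X)

lemma q_singles:
  assumes "x \<in> X"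
  shows "q (itinerary T b (m + N) x) \<ge> exp (- c * m) * q (itinerary T b N ((T ^^ m) x))"
  using assms
proof (induction m arbitrary: x)
  case (Suc m)
  have "exp (- c * Suc m) * q (itinerary T b N ((T ^^ Suc m) x)) =
      exp (- c) * (exp (- c * m) * q (itinerary T b N ((T ^^ m) (T x))))"
    by (simp add: funpow_swap1 algebra_simps flip: exp_add)
  also have "\<dots> \<le> exp (- c) * q (itinerary T b (m + N) (T x))"
    using Suc by (intro mult_left_mono Suc.IH X) auto
  also have "\<dots> \<le> q (itinerary T b (Suc m + N) x)"
    using q_Cons[OF Suc.prems] by (simp add: itinerary_Suc)
  finally show ?case .
qed simp

lemma q_all_singles:
  assumes "x \<in> X" shows "q (itinerary T b N x) \<ge> exp (- c * N)"
  using q_singles[OF assms, of N 0] by (simp add: q_Nil)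

text \<open>
  Paying for the first \<open>m\<close> letters one by one. Those at times in \<open>R\<close> are accounted for by the number
  of visits to \<open>R\<close>, and \<open>k\<close> counts the others.
\<close>
lemma q_singles_bound:
  assumes x: "x \<in> X" and "m \<le> N"
    and IH: "q (itinerary T b (N - m) ((T ^^ m) x)) \<ge>
      exp (- (\<kappa> * real (N - m) + c * (visits T R (N - m) ((T ^^ m) x) + L)))"
    and V: "m \<le> visits T R m x + k"
  shows "q (itinerary T b N x) \<ge> exp (- (\<kappa> * N + c * (visits T R N x + L + k)))"
proof -
  let ?V = "visits T R (N - m) ((T ^^ m) x)"
  have vis: "visits T R N x = visits T R m x + ?V"
    using visits_add[of T R m "N - m" x] \<open>m \<le> N\<close> by simp
  have "\<kappa> * real (N - m) \<le> \<kappa> * real N" using \<kappa> by (intro mult_left_mono) auto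
  moreover have "c * m \<le> c * (visits T R m x + k)" using V c by (intro mult_left_mono) auto
  ultimately have "- (\<kappa> * N + c * (visits T R N x + L + k)) \<le> - c * m + - (\<kappa> * real (N - m) + c * (?V + L))"
    unfolding vis by (simp add: algebra_simps)
  then have "exp (- (\<kappa> * N + c * (visits T R N x + L + k))) \<le>
      exp (- c * m) * exp (- (\<kappa> * real (N - m) + c * (?V + L)))"
    by (simp flip: exp_add)
  also have "\<dots> \<le> exp (- c * m) * q (itinerary T b (N - m) ((T ^^ m) x))"
    by (intro mult_left_mono IH) auto
  also have "\<dots> \<le> q (itinerary T b N x)"
    using q_singles[OF x, of m "N - m"] \<open>m \<le> N\<close> by simp
  finally show ?thesis .
qed

lemma short_bound:
  assumes "x \<in> X" "N \<le> L" "k \<ge> 0"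
  shows "q (itinerary T b N x) \<ge> exp (- (\<kappa> * N + c * (visits T R N x + L + k)))"
proof -
  have "c * N \<le> c * (visits T R N x + L + k)"
    using visits_nonneg[of T R N x] c assms by (intro mult_left_mono) auto
  moreover have "\<kappa> * N \<ge> 0" using \<kappa> by simp
  ultimately have "exp (- (\<kappa> * N + c * (visits T R N x + L + k))) \<le> exp (- c * N)" by simp
  then show ?thesis using q_all_singles[OF assms(1), of N] by linarith
qed

text \<open>
  At a fresh point, where the scan has just taken a new word, there are three cases. If \<open>\<omega>\<close> proposes
  nothing, the point is in \<open>R\<close> and one letter is paid for. If \<open>B\<close> is visited before the word ends, the
  letters up to that visit are in \<open>R\<close> and are paid for one by one. Otherwise the word is complete and
  is paid for as a whole. In each case the next point is fresh again, unless the time \<open>N\<close> runs out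
  within the word; this costs at most \<open>L\<close> single letters, once.
\<close>
lemma fresh_bound:
  assumes "x \<in> X" "\<sigma> x = \<omega> x"
  shows "q (itinerary T b N x) \<ge> exp (- (\<kappa> * N + c * (visits T R N x + L)))"
  using assms
proof (induction N arbitrary: x rule: less_induct)
  case (less N)
  note x = less.prems
  have short: ?case if "N \<le> L" using short_bound[OF x(1) that, of 0] by simp
  consider (bad) "\<omega> x = []" | (cut) j where "1 \<le> j" "j < length (\<omega> x)" "(T ^^ j) x \<in> B" "\<omega> x \<in> W"
    | (full) "\<omega> x \<in> W" "\<And>j. 1 \<le> j \<Longrightarrow> j < length (\<omega> x) \<Longrightarrow> (T ^^ j) x \<notin> B"
    using \<omega>[OF x(1)] by (cases "\<omega> x = []") blast+
  then show ?case
  proof cases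
    case bad
    show ?thesis
    proof (cases "N = 0")
      case False
      have "\<sigma> (T x) = \<omega> (T x)" using \<sigma>[OF x(1)] bad x(2) by simp
      moreover have "x \<in> R" using bad by (simp add: R_def)
      ultimately show ?thesis
        using False less.IH[of "N - 1" "T x"] X[OF x(1)]
          q_singles_bound[OF x(1), of 1 N 0] by (simp add: visits_def)
    qed (use short in simp)
  next
    case cut
    then have jL: "j \<le> L" using L(1) by force
    show ?thesis
    proof (cases "j \<le> N")
      case True
      obtain i where j: "j = Suc i" using cut(1) by (cases j) auto
      have "\<sigma> ((T ^^ j) x) = \<omega> ((T ^^ j) x)"
        using \<sigma>[OF X_power[OF x(1)], of i] cut(3) unfolding j by simp
      moreover have "(T ^^ i) x \<in> R" if "i < j" for i
      proof -
        have "(T ^^ (j - i)) ((T ^^ i) x) = (T ^^ j) x"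
          using that funpow_add[of "j - i" i T, THEN fun_cong, of x] by simp
        then show ?thesis
          using that jL cut(3) unfolding R_def by (auto intro!: bexI[of _ "j - i"])
      qed
      then have "visits T R j x = j" by (simp add: visits_def)
      ultimately show ?thesis
        using True cut(1) less.IH[of "N - j" "(T ^^ j) x"] X_power[OF x(1)]
          q_singles_bound[OF x(1), of j N 0] by simp
    qed (use short jL in simp)
  next
    case full
    let ?w = "\<omega> x"
    have wL: "length ?w \<le> L" using L(1) full(1) by blast
    have w0: "length ?w > 0" using full(1) Nil by auto
    show ?thesis
    proof (cases "length ?w \<le> N")
      case True
      let ?l = "length ?w" and ?y = "(T ^^ length ?w) x"
      have drop: "\<sigma> ((T ^^ i) x) = drop i ?w" if "i < ?l" for i
        using that
      proof (induction i)
        case (Suc i)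
        then show ?case
          using \<sigma>[OF X_power[OF x(1)], of i] full(2)[of "Suc i"] by (simp add: tl_drop drop_Suc)
      qed (use x in simp)
      have "b ((T ^^ i) x) = ?w ! i" if "i < ?l" for i
        using drop[OF that] b[OF X_power[OF x(1)], of i] that by (simp add: hd_drop_conv_nth)
      then have "itinerary T b ?l x = ?w"
        by (intro nth_equalityI) (auto simp: nth_itinerary)
      then have split: "itinerary T b N x = ?w @ itinerary T b (N - ?l) ?y"
        using itinerary_append[of T b ?l "N - ?l" x] True by simp
      obtain i where l: "?l = Suc i" using w0 by (cases ?l) auto
      have "\<sigma> ?y = \<omega> ?y"
        using \<sigma>[OF X_power[OF x(1)], of i] drop[of i] l by simp
      then have IH: "q (itinerary T b (N - ?l) ?y) \<ge>
          exp (- (\<kappa> * real (N - ?l) + c * (visits T R (N - ?l) ?y + L)))"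
      proof -
        have "N - ?l < N" using w0 True by linarith
        then show ?thesis using less.IH X_power[OF x(1)] \<open>\<sigma> ?y = \<omega> ?y\<close> by blast
      qed
      have "visits T R (N - ?l) ?y \<le> visits T R N x"
        using visits_add[of T R ?l "N - ?l" x] visits_nonneg[of T R ?l x] True by simp
      then have "c * visits T R (N - ?l) ?y \<le> c * visits T R N x" using c by (rule mult_left_mono)
      then have "- (\<kappa> * N + c * (visits T R N x + L)) \<le>
          - \<kappa> * ?l + - (\<kappa> * real (N - ?l) + c * (visits T R (N - ?l) ?y + L))"
        using True by (simp add: of_nat_diff algebra_simps)
      then have "exp (- (\<kappa> * N + c * (visits T R N x + L))) \<le>
          exp (- \<kappa> * ?l) * exp (- (\<kappa> * real (N - ?l) + c * (visits T R (N - ?l) ?y + L)))"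
        by (simp flip: exp_add)
      also have "\<dots> \<le> exp (- \<kappa> * ?l) * q (itinerary T b (N - ?l) ?y)"
        by (intro mult_left_mono IH) auto
      also have "\<dots> \<le> q (itinerary T b N x)" unfolding split by (rule q_append[OF full(1)])
      finally show ?thesis .
    qed (use short wL in simp)
  qed
qed

text \<open>An orbit segment may begin in the middle of a word, which ends after at most \<open>L\<close> steps.\<close>
lemma reach_fresh:
  assumes "x \<in> X"
  shows "\<exists>k\<le>L. \<sigma> ((T ^^ k) x) = \<omega> ((T ^^ k) x)"
proof -
  have "\<exists>k\<le>max 1 (length (\<sigma> x)). \<sigma> ((T ^^ k) x) = \<omega> ((T ^^ k) x)"
    using assms
  proof (induction "length (\<sigma> x)" arbitrary: x rule: less_induct)
    case (less x)
    show ?case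
    proof (cases "T x \<in> B \<or> length (\<sigma> x) \<le> 1")
      case True
      then show ?thesis using \<sigma>[OF less.prems] by (intro exI[of _ 1]) auto
    next
      case False
      then have tl: "\<sigma> (T x) = tl (\<sigma> x)" using \<sigma>[OF less.prems] by simp
      have "length (\<sigma> (T x)) < length (\<sigma> x)" using tl False by (cases "\<sigma> x") auto
      then obtain k where "k \<le> max 1 (length (\<sigma> (T x)))" "\<sigma> ((T ^^ k) (T x)) = \<omega> ((T ^^ k) (T x))"
        using less.hyps[of "T x"] X[OF less.prems] by blast
      then show ?thesis
        using False tl by (intro exI[of _ "Suc k"]) (auto simp: funpow_swap1)
    qed
  qed
  then show ?thesis using \<sigma>L[OF assms] L(2) by (meson max.boundedI order_trans)
qed

lemma weight_itinerary:
  assumes x: "x \<in> X"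
  shows "q (itinerary T b N x) \<ge> exp (- (\<kappa> * N + c * (visits T R N x + 2 * L)))"
proof -
  obtain k where k: "k \<le> L" "\<sigma> ((T ^^ k) x) = \<omega> ((T ^^ k) x)" using reach_fresh[OF x] by blast
  show ?thesis
  proof (cases "k \<le> N")
    case True
    have "real k \<le> visits T R k x + L" using k(1) visits_nonneg[of T R k x] by simp
    then show ?thesis
      using q_singles_bound[OF x True, of L] fresh_bound[OF X_power[OF x, of k] k(2), of "N - k"]
      by (simp add: add.assoc)
  next
    case False
    then show ?thesis using short_bound[OF x, of N L] k(1) by (simp add: add.assoc)
  qed
qed

end

section \<open>Compressible labellings\<close>

context measure_dynamical_system
begin

lemma expectation_visits:
  assumes [measurable]: "R \<in> sets M"
  shows "integrable M (visits T R n)" "expectation (visits T R n) = n * prob R"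
proof -
  have eq: "indicator R ((T ^^ j) x) = (indicator ((T ^^ j) -` R \<inter> space M) x :: real)"
    if "x \<in> space M" for x j
    using that by (auto simp: indicator_def)
  have meas: "(T ^^ j) -` R \<inter> space M \<in> sets M" for j by measurable
  have vis: "visits T R n x = (\<Sum>j<n. indicator ((T ^^ j) -` R \<inter> space M) x)" if "x \<in> space M" for x
    unfolding visits_def by (intro sum.cong refl eq that)
  have int: "integrable M (indicator ((T ^^ j) -` R \<inter> space M) :: 'a \<Rightarrow> real)" for j
    using meas by (intro integrable_real_indicator) (auto simp: emeasure_eq_measure)
  then have "integrable M (\<lambda>x. \<Sum>j<n. indicator ((T ^^ j) -` R \<inter> space M) x :: real)"
    by (intro Bochner_Integration.integrable_sum)
  then show "integrable M (visits T R n)"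
    by (subst Bochner_Integration.integrable_cong[OF refl vis]) auto
  have "expectation (visits T R n) = expectation (\<lambda>x. \<Sum>j<n. indicator ((T ^^ j) -` R \<inter> space M) x)"
    by (intro Bochner_Integration.integral_cong refl vis)
  also have "\<dots> = (\<Sum>j<n. expectation (indicator ((T ^^ j) -` R \<inter> space M)))"
    by (intro Bochner_Integration.integral_sum int)
  also have "\<dots> = (\<Sum>j<n. prob R)"
    using meas by (intro sum.cong refl) (simp add: prob_vimage_T_power[OF assms] Int_absorb1)
  finally show "expectation (visits T R n) = n * prob R" by simp
qed

end

text \<open>
  The scan of the words from \<open>exists_word_selector\<close>, started at the visits to \<open>B\<close>. The exceptional
  set is small because \<open>\<omega>\<close> rarely proposes nothing and because \<open>B\<close> has measure much smaller than
  \<open>1 / L\<close>. The summand \<open>2 * L\<close> pays for the words cut by the two ends of the segment.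
\<close>
lemma (in ergodic_dynamical_system) exists_compressible_labelling:
  fixes h \<delta> \<rho> :: real
  assumes U: "is_cover M U" and h: "0 \<le> h" and \<epsilon>: "0 < \<epsilon>" "\<epsilon> < 1"
    and freq: "\<exists>\<^sub>\<infinity>n. cover_number M (iterated_cover M T U n) \<epsilon> \<le> exp (n * h)"
    and small: "\<forall>\<eta>>0. \<exists>B\<in>sets M. 0 < prob B \<and> prob B < \<eta>"
    and \<delta>: "0 < \<delta>" and \<rho>: "0 < \<rho>"
  obtains b R q L where "labelling M U b" "\<And>x. x \<in> space M \<Longrightarrow> x \<in> b x"
    "R \<in> sets M" "prob R \<le> \<rho>"
    "\<And>v. q v > 0" "\<And>n. (\<Sum>v\<in>words U n. q v) \<le> 1"
    "AE x in M. \<forall>n. q (itinerary T b n x) \<ge>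
       exp (- ((h + \<delta>) * n + ln (2 * real (card U)) * (visits T R n x + 2 * real (L :: nat))))"
proof -
  interpret S: measure_dynamical_system M S by (rule inverse_system)
  have finU: "finite U" and setsU: "U \<subseteq> sets M" and Un: "\<Union>U = space M"
    using U by (auto simp: is_cover_def)
  have "U \<noteq> {}" using Un not_empty by auto
  then have cardU: "card U \<ge> 1" using finU by (simp add: Suc_le_eq card_gt_0_iff)
  define \<kappa> where "\<kappa> = h + \<delta>"
  have \<kappa>: "h < \<kappa>" "0 \<le> \<kappa>" using h \<delta> by (auto simp: \<kappa>_def)
  obtain W \<omega> where W: "finite W" "[] \<notin> W" "\<And>w. w \<in> W \<Longrightarrow> set w \<subseteq> U"
    "(\<Sum>w\<in>W. exp (- \<kappa> * length w)) \<le> 1/2"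
    and \<omega> [measurable]: "\<omega> \<in> measurable M (count_space UNIV)"
    and \<omega>W: "\<And>x. x \<in> space M \<Longrightarrow> \<omega> x \<in> insert [] W \<and> follows T x (\<omega> x)"
    and \<omega>_prob: "prob {x \<in> space M. \<omega> x = []} < \<rho> / 2"
    using exists_word_selector[OF U \<kappa> \<epsilon> half_gt_zero[OF \<rho>] freq] by blast
  define L where "L = Max (insert 1 (length ` W))"
  have L: "L \<ge> 1" "length w \<le> L" if "w \<in> W" for w
    using W(1) that by (auto simp: L_def intro!: Max_ge)
  have L1: "L \<ge> 1" using W(1) by (auto simp: L_def intro!: Max_ge)
  obtain B where B [measurable]: "B \<in> sets M" and B_prob: "0 < prob B" "prob B < \<rho> / (2 * L)"
    using small[rule_format, of "\<rho> / (2 * L)"] \<rho> L1 by auto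
  define \<sigma> where "\<sigma> = pending_word \<omega> B"
  obtain b0 where b0: "labelling M U b0" "\<And>x. x \<in> space M \<Longrightarrow> x \<in> b0 x"
    using cover_labelling[OF U] by blast
  define b where "b x = (if \<sigma> x = [] then b0 x else hd (\<sigma> x))" for x
  have inv: "follows T x (\<sigma> x) \<and> set (\<sigma> x) \<subseteq> U \<and> length (\<sigma> x) \<le> L" if "x \<in> space M" for x
    unfolding \<sigma>_def
  proof (rule pending_word_invariant[OF that])
    fix y assume "y \<in> space M"
    then show "follows T y (\<omega> y) \<and> set (\<omega> y) \<subseteq> U \<and> length (\<omega> y) \<le> L"
      using \<omega>W[of y] W(3) L(2) by auto
  next
    fix y and w :: "'a set list"
    assume "follows T y w \<and> set w \<subseteq> U \<and> length w \<le> L" "1 < length w"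
    then show "follows T (T y) (tl w) \<and> set (tl w) \<subseteq> U \<and> length (tl w) \<le> L"
      by (cases w) (auto simp: follows_Cons)
  qed auto
  have b_in: "b x \<in> U" "x \<in> b x" if "x \<in> space M" for x
    using inv[OF that] b0 that by (cases "\<sigma> x"; auto simp: b_def follows_Cons labelling_def)+
  have \<sigma>_meas: "\<sigma> \<in> measurable M (count_space UNIV)"
    unfolding \<sigma>_def by (rule pending_word_measurable[OF \<omega> B])
  have "{x \<in> space M. \<sigma> x = []} \<in> sets M" using \<sigma>_meas by measurable
  moreover have "(\<lambda>x. hd (\<sigma> x)) \<in> measurable M (count_space UNIV)"
    using \<sigma>_meas by (rule measurable_compose) simp
  moreover have "b0 \<in> measurable M (count_space UNIV)" using b0 by (simp add: labelling_def)
  ultimately have "b \<in> measurable M (count_space UNIV)" unfolding b_def by (intro measurable_If)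
  then have b: "labelling M U b" using b_in finU by (auto simp: labelling_def)
  define X where "X = {x \<in> space M. \<exists>r. (S ^^ r) x \<in> B}"
  have X_prob: "prob X = 1" unfolding X_def using B B_prob by (intro prob_past_visit)
  define c where "c = ln (2 * real (card U))"
  have c: "c \<ge> 0" "exp (- c) = 1 / (2 * card U)" using cardU by (auto simp: c_def exp_minus field_simps)
  define q where "q = block_weight (1 / (2 * card U)) \<kappa> W"
  interpret scan: scanned_orbit T X B L W \<omega> \<sigma> b q c \<kappa>
  proof
    fix x assume x: "x \<in> X"
    then obtain r where r: "x \<in> space M" "(S ^^ r) x \<in> B" by (auto simp: X_def)
    have "(S ^^ Suc r) (T x) = (S ^^ r) x"
      using r(1) by (simp only: funpow_Suc_right comp_apply S_T)
    then have "\<exists>r. (S ^^ r) (T x) \<in> B" using r(2) by metis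
    then show "T x \<in> X" unfolding X_def using T_power_space[OF r(1), of 1] by simp
    show "\<sigma> (T x) = (if T x \<in> B \<or> length (\<sigma> x) \<le> 1 then \<omega> (T x) else tl (\<sigma> x))"
      unfolding \<sigma>_def using r by (intro pending_word_step) auto
    show "\<omega> x \<in> insert [] W" using \<omega>W r(1) by blast
    show "length (\<sigma> x) \<le> L" using inv[OF r(1)] by simp
    show "exp (- c) * q v \<le> q (b x # v)" for v
      unfolding c q_def by (rule block_weight_Cons) simp
  next
    show "exp (- \<kappa> * length w) * q v \<le> q (w @ v)" if "w \<in> W" for w v
      unfolding q_def using W that by (intro block_weight_append) auto
  qed (use L L1 W(2) c \<kappa> in \<open>auto simp: b_def q_def block_weight_nonneg\<close>)
  define R where "R = scan.R \<inter> space M"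
  have R_eq: "R = {x \<in> space M. \<omega> x = []} \<union> (\<Union>j\<in>{1..L}. (T ^^ j) -` B \<inter> space M)"
    unfolding R_def scan.R_def by auto
  have R_sets: "R \<in> sets M" unfolding R_eq by measurable
  have "prob R \<le> prob {x \<in> space M. \<omega> x = []} + prob (\<Union>j\<in>{1..L}. (T ^^ j) -` B \<inter> space M)"
    unfolding R_eq by (rule measure_Un_le) measurable
  also have "prob (\<Union>j\<in>{1..L}. (T ^^ j) -` B \<inter> space M) \<le> (\<Sum>j\<in>{1..L}. prob ((T ^^ j) -` B \<inter> space M))"
    by (intro measure_UNION_le) auto
  also have "\<dots> = L * prob B" by (simp add: prob_vimage_T_power[OF B])
  also have "L * prob B \<le> \<rho> / 2" using B_prob(2) L1 by (simp add: field_simps)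
  finally have R_prob: "prob R \<le> \<rho>" using \<omega>_prob by simp
  have "visits T scan.R n x = visits T R n x" if "x \<in> space M" for n x
    unfolding visits_def R_def using T_power_space[OF that]
    by (intro sum.cong) (auto simp: indicator_def)
  then have "\<forall>n. q (itinerary T b n x) \<ge> exp (- (\<kappa> * n + c * (visits T R n x + 2 * real L)))"
    if "x \<in> X" for x
    using scan.weight_itinerary[OF that] that by (simp add: X_def)
  then have ae: "AE x in M. \<forall>n. q (itinerary T b n x) \<ge> exp (- (\<kappa> * n + c * (visits T R n x + 2 * real L)))"
    by (intro AE_mp[OF AE_prob_1[OF X_prob] AE_I2]) blast
  show thesis
  proof (rule that[OF b b_in(2) R_sets R_prob])
    show "q v > 0" for v unfolding q_def using cardU by (intro block_weight_pos) simp
    show "(\<Sum>v\<in>words U n. q v) \<le> 1" for n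
      unfolding q_def using finU W cardU by (intro sum_block_weight_le_1) auto
    show "AE x in M. \<forall>n. q (itinerary T b n x) \<ge>
       exp (- ((h + \<delta>) * n + ln (2 * real (card U)) * (visits T R n x + 2 * real L)))"
      using ae unfolding \<kappa>_def c_def .
  qed
qed

text \<open>
  Integrate the bound on \<open>- ln q\<close>: by invariance the expected number of visits to \<open>R\<close> is
  \<open>n * prob R\<close>, and Gibbs' inequality bounds the entropy by the expectation of \<open>- ln q\<close>.
\<close>
lemma (in ergodic_dynamical_system) exists_low_entropy_partition:
  fixes h \<delta> :: real
  assumes U: "is_cover M U" and h: "0 \<le> h" and \<epsilon>: "0 < \<epsilon>" "\<epsilon> < 1"
    and freq: "\<exists>\<^sub>\<infinity>n. cover_number M (iterated_cover M T U n) \<epsilon> \<le> exp (n * h)"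
    and small: "\<forall>\<eta>>0. \<exists>B\<in>sets M. 0 < prob B \<and> prob B < \<eta>"
    and \<delta>: "0 < \<delta>"
  obtains P where "is_partition M P" "finer_cover P U" "partition_entropy M T P \<le> h + \<delta>"
proof -
  define c where "c = ln (2 * real (card U))"
  have "U \<noteq> {}" "finite U" using U not_empty by (auto simp: is_cover_def)
  then have "card U \<ge> 1" by (simp add: Suc_le_eq card_gt_0_iff)
  then have c: "c \<ge> 0" by (simp add: c_def)
  define \<rho> where "\<rho> = \<delta> / (2 * (c + 1))"
  have \<rho>: "\<rho> > 0" "c * \<rho> \<le> \<delta> / 2" using c \<delta> by (auto simp: \<rho>_def field_simps)
  obtain b R q L where b: "labelling M U b" "\<And>x. x \<in> space M \<Longrightarrow> x \<in> b x"
    and R: "R \<in> sets M" "prob R \<le> \<rho>"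
    and q: "\<And>v. q v > 0" "\<And>n. (\<Sum>v\<in>words U n. q v) \<le> 1"
    and code: "AE x in M. \<forall>n. q (itinerary T b n x) \<ge>
       exp (- ((h + \<delta> / 2) * n + c * (visits T R n x + 2 * real (L :: nat))))"
    by (rule exists_compressible_labelling[OF U h \<epsilon> freq small half_gt_zero[OF \<delta>] \<rho>(1),
          folded c_def]) (rule that)
  have bound: "label_entropy U b n \<le> (h + \<delta>) * n + 2 * c * L" for n
  proof -
    have "label_entropy U b n \<le> - (\<Sum>v\<in>words U n. word_prob b v * ln (q v))"
      using q by (intro label_entropy_le[OF b(1)]) (auto intro: less_imp_le)
    also have "\<dots> = expectation (\<lambda>x. - ln (q (itinerary T b n x)))"
      using expectation_itinerary(2)[OF b(1), of "\<lambda>v. - ln (q v)" n] by (simp add: sum_negf)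
    also have "\<dots> \<le> expectation (\<lambda>x. (h + \<delta> / 2) * n + c * (visits T R n x + 2 * real L))"
    proof (rule integral_mono_AE)
      show "integrable M (\<lambda>x. - ln (q (itinerary T b n x)))"
        by (rule expectation_itinerary(1)[OF b(1), of "\<lambda>v. - ln (q v)"])
      show "integrable M (\<lambda>x. (h + \<delta> / 2) * n + c * (visits T R n x + 2 * real L))"
        using expectation_visits(1)[OF R(1)] by simp
      have "- ln (q v) \<le> z" if "q v \<ge> exp (- z)" for v z
      proof -
        have "- z \<le> ln (q v)" using that q(1)[of v] by (simp add: ln_ge_iff)
        then show ?thesis by simp
      qed
      then show "AE x in M. - ln (q (itinerary T b n x)) \<le> (h + \<delta> / 2) * n + c * (visits T R n x + 2 * real L)"
        by (intro AE_mp[OF code AE_I2]) blast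
    qed
    also have "\<dots> = (h + \<delta> / 2) * n + c * (n * prob R + 2 * L)"
      using expectation_visits[OF R(1)] by (simp add: prob_space)
    also have "\<dots> \<le> (h + \<delta>) * n + 2 * c * L"
    proof -
      have "c * prob R \<le> \<delta> / 2" using R(2) \<rho>(2) c mult_left_mono[of "prob R" \<rho> c] by linarith
      then have "n * (c * prob R) \<le> n * (\<delta> / 2)" by (intro mult_left_mono) auto
      then show ?thesis by (simp add: algebra_simps)
    qed
    finally show ?thesis .
  qed
  show thesis
  proof (rule that)
    show "is_partition M (label_partition M U b)" by (rule label_partition_is_partition[OF b(1)])
    show "finer_cover (label_partition M U b) U" by (rule label_partition_finer[OF b(2)])
    show "partition_entropy M T (label_partition M U b) \<le> h + \<delta>"
    proof (rule LIMSEQ_le)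
      show "(\<lambda>n. label_entropy U b n / n) \<longlonglongrightarrow> partition_entropy M T (label_partition M U b)"
        by (rule partition_entropy_limit[OF b(1)])
      show "(\<lambda>n. (h + \<delta>) + 2 * c * L / real n) \<longlonglongrightarrow> h + \<delta>"
        using tendsto_add[OF tendsto_const lim_const_over_n] by simp
      have "label_entropy U b n / n \<le> (h + \<delta>) + 2 * c * L / n" if "n \<ge> 1" for n
        using bound[of n] that by (simp add: field_simps)
      then show "\<exists>N. \<forall>n\<ge>N. label_entropy U b n / n \<le> (h + \<delta>) + 2 * c * L / n" by blast
    qed
  qed
qed

text \<open>
  By Markov's inequality the visits to \<open>R\<close> exceed \<open>\<theta> * n\<close> only with probability
  \<open>prob R / \<theta> < \<epsilon>'\<close>. All other itineraries have large weight, so there are few of them. This is why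
  the growth rate does not depend on \<open>\<epsilon>\<close>.
\<close>
lemma (in ergodic_dynamical_system) cover_number_eventually_le:
  fixes h \<delta> \<epsilon> \<epsilon>' :: real
  assumes U: "is_cover M U" and h: "0 \<le> h" and \<epsilon>: "0 < \<epsilon>" "\<epsilon> < 1"
    and freq: "\<exists>\<^sub>\<infinity>n. cover_number M (iterated_cover M T U n) \<epsilon> \<le> exp (n * h)"
    and small: "\<forall>\<eta>>0. \<exists>B\<in>sets M. 0 < prob B \<and> prob B < \<eta>"
    and \<delta>: "0 < \<delta>" and \<epsilon>': "0 < \<epsilon>'"
  shows "\<forall>\<^sub>F n in sequentially. cover_number M (iterated_cover M T U n) \<epsilon>' \<le> exp (n * (h + \<delta>))"
proof -
  define c where "c = ln (2 * real (card U))"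
  have "U \<noteq> {}" "finite U" using U not_empty by (auto simp: is_cover_def)
  then have "card U \<ge> 1" by (simp add: Suc_le_eq card_gt_0_iff)
  then have c: "c \<ge> 0" by (simp add: c_def)
  define \<theta> where "\<theta> = \<delta> / (4 * (c + 1))"
  have \<theta>: "\<theta> > 0" "c * \<theta> \<le> \<delta> / 4" using c \<delta> by (auto simp: \<theta>_def field_simps)
  define \<rho> where "\<rho> = \<theta> * \<epsilon>' / 2"
  have \<rho>: "\<rho> > 0" "\<rho> / \<theta> < \<epsilon>'" using \<theta> \<epsilon>' by (auto simp: \<rho>_def)
  have \<delta>4: "0 < \<delta> / 4" using \<delta> by simp
  obtain b R q L where b: "labelling M U b" "\<And>x. x \<in> space M \<Longrightarrow> x \<in> b x"
    and R: "R \<in> sets M" "prob R \<le> \<rho>"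
    and q: "\<And>v. q v > 0" "\<And>n. (\<Sum>v\<in>words U n. q v) \<le> 1"
    and code: "AE x in M. \<forall>n. q (itinerary T b n x) \<ge>
       exp (- ((h + \<delta> / 4) * n + c * (visits T R n x + 2 * real (L :: nat))))"
    by (rule exists_compressible_labelling[OF U h \<epsilon> freq small \<delta>4 \<rho>(1), folded c_def])
       (rule that)
  have bound: "cover_number M (iterated_cover M T U n) \<epsilon>' \<le>
      exp ((h + \<delta> / 4) * n + c * (\<theta> * n + 2 * L))" if n: "n \<ge> 1" for n
  proof -
    define K where "K = {v \<in> words U n. q v \<ge> exp (- ((h + \<delta> / 4) * n + c * (\<theta> * n + 2 * L)))}"
    have fin: "finite (words U n)" using \<open>finite U\<close> by (rule finite_words)
    have "(\<Sum>v\<in>words U n - K. word_prob b v) = prob {x \<in> space M. itinerary T b n x \<in> words U n - K}"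
      by (rule prob_itinerary_in[OF b(1), symmetric]) auto
    also have "\<dots> \<le> prob {x \<in> space M. visits T R n x \<ge> \<theta> * n}"
    proof (rule finite_measure_mono_AE)
      have "visits T R n x \<ge> \<theta> * n"
        if "itinerary T b n x \<in> words U n - K"
          "\<forall>n. q (itinerary T b n x) \<ge> exp (- ((h + \<delta> / 4) * n + c * (visits T R n x + 2 * real L)))" for x
      proof (rule ccontr)
        assume "\<not> ?thesis"
        then have "c * (visits T R n x + 2 * L) \<le> c * (\<theta> * n + 2 * L)"
          using c by (intro mult_left_mono) auto
        then have "exp (- ((h + \<delta> / 4) * n + c * (\<theta> * n + 2 * L))) \<le>
            exp (- ((h + \<delta> / 4) * n + c * (visits T R n x + 2 * real L)))" by simp
        also have "\<dots> \<le> q (itinerary T b n x)" using that(2) by blast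
        finally show False using that(1) by (auto simp: K_def)
      qed
      then show "AE x in M. x \<in> {x \<in> space M. itinerary T b n x \<in> words U n - K} \<longrightarrow>
          x \<in> {x \<in> space M. visits T R n x \<ge> \<theta> * n}"
        by (intro AE_mp[OF code AE_I2]) blast
      have [measurable]: "visits T R n \<in> borel_measurable M"
        using expectation_visits(1)[OF R(1)] by (rule borel_measurable_integrable)
      show "{x \<in> space M. visits T R n x \<ge> \<theta> * n} \<in> sets M" by measurable
    qed
    also have "\<dots> \<le> expectation (visits T R n) / (\<theta> * n)"
      using \<theta> n expectation_visits(1)[OF R(1)]
      by (intro integral_Markov_inequality_measure[where A = "{}"] AE_I2 visits_nonneg) auto
    also have "\<dots> = prob R / \<theta>" using expectation_visits(2)[OF R(1), of n] n by simp
    also have "\<dots> \<le> \<rho> / \<theta>" using R(2) \<theta> by (intro divide_right_mono) auto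
    also have "\<dots> < \<epsilon>'" by (rule \<rho>)
    finally have "cover_number M (iterated_cover M T U n) \<epsilon>' \<le> card K"
      using b(2) by (intro cover_number_le_itinerary[OF b(1), of id]) (auto simp: K_def)
    moreover have "real (card K) \<le> exp ((h + \<delta> / 4) * n + c * (\<theta> * n + 2 * L))" (is "_ \<le> exp ?z")
    proof -
      have "card K * exp (- ?z) = (\<Sum>v\<in>K. exp (- ?z))" by simp
      also have "\<dots> \<le> (\<Sum>v\<in>K. q v)" by (rule sum_mono) (auto simp: K_def)
      also have "\<dots> \<le> (\<Sum>v\<in>words U n. q v)"
        using fin q(1) by (intro sum_mono2) (auto simp: K_def less_imp_le)
      also have "\<dots> \<le> 1" by (rule q)
      finally show ?thesis by (simp add: exp_minus field_simps)
    qed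
    ultimately show ?thesis by linarith
  qed
  have "(\<lambda>n. 2 * c * L / real n) \<longlonglongrightarrow> 0" by (rule lim_const_over_n)
  then have "\<forall>\<^sub>F n in sequentially. 2 * c * L / real n < \<delta> / 4"
    using \<delta>4 by (rule order_tendstoD(2))
  then show ?thesis
    using eventually_ge_at_top[of 1]
  proof eventually_elim
    case (elim n)
    then have "2 * c * L \<le> n * (\<delta> / 4)" by (simp add: field_simps)
    moreover have "n * (c * \<theta>) \<le> n * (\<delta> / 4)" using \<theta>(2) by (intro mult_left_mono) auto
    moreover have "n * \<delta> \<ge> 0" using \<delta> by simp
    ultimately have "(h + \<delta> / 4) * n + c * (\<theta> * n + 2 * L) \<le> n * (h + \<delta>)"
      by (simp add: algebra_simps)
    then show ?case using bound[OF elim(2)] by (meson exp_le_cancel_iff order_trans)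
  qed
qed

section \<open>Entropy bounds and systems without small sets\<close>

context measure_dynamical_system
begin

lemma partition_itinerary_entropy:
  assumes "is_partition M P" "finer_cover P U"
  obtains b c where "labelling M P b" "c ` P \<subseteq> U" "\<And>x. x \<in> space M \<Longrightarrow> x \<in> c (b x)"
    "(\<lambda>n. label_entropy P b n / n) \<longlonglongrightarrow> partition_entropy M T P"
proof -
  obtain b where b: "labelling M P b" "label_partition M P b = P" "\<And>x. x \<in> space M \<Longrightarrow> x \<in> b x"
    using partition_labelling[OF assms(1)] by blast
  have "\<forall>A\<in>P. \<exists>B. B \<in> U \<and> A \<subseteq> B" using assms(2) by (auto simp: finer_cover_def)
  then obtain c where c: "\<forall>A\<in>P. c A \<in> U \<and> A \<subseteq> c A" by (rule bchoice[THEN exE])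
  show thesis
  proof (rule that[of b c])
    show "x \<in> c (b x)" if "x \<in> space M" for x
      using b(1) b(3)[OF that] c that by (auto simp: labelling_def)
    show "(\<lambda>n. label_entropy P b n / n) \<longlonglongrightarrow> partition_entropy M T P"
      using partition_entropy_limit[OF b(1)] unfolding b(2) .
  qed (use b c in auto)
qed

lemma partition_entropy_nonneg:
  assumes "is_partition M P"
  shows "partition_entropy M T P \<ge> 0"
proof -
  have "finer_cover P P" by (auto simp: finer_cover_def)
  then obtain b where "(\<lambda>n. label_entropy P b n / n) \<longlonglongrightarrow> partition_entropy M T P"
    by (rule partition_itinerary_entropy[OF assms]) (rule that)
  then show ?thesis by (rule LIMSEQ_le_const) (auto simp: label_entropy_nonneg)
qed

lemma exists_finer_partition:
  assumes "is_cover M U"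
  obtains P where "is_partition M P" "finer_cover P U"
proof -
  obtain b where b: "labelling M U b" "\<And>x. x \<in> space M \<Longrightarrow> x \<in> b x"
    using cover_labelling[OF assms] by blast
  show thesis
  proof (rule that)
    show "is_partition M (label_partition M U b)" by (rule label_partition_is_partition[OF b(1)])
    show "finer_cover (label_partition M U b) U" by (rule label_partition_finer[OF b(2)])
  qed
qed

lemma card_positive_words_le:
  assumes b: "labelling M A b" and \<eta>: "0 < \<eta>" "\<And>B. B \<in> sets M \<Longrightarrow> prob B = 0 \<or> prob B \<ge> \<eta>"
  shows "card {v \<in> words A n. word_prob b v > 0} \<le> 1 / \<eta>"
    and "v \<in> words A n \<Longrightarrow> word_prob b v > 0 \<Longrightarrow> word_prob b v \<ge> \<eta>"
proof -
  have ge: "word_prob b v \<ge> \<eta>" if "word_prob b v > 0" for v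
    using \<eta>(2)[OF itinerary_measurable[of b "length v" v]] b that
    by (auto simp: word_prob_def labelling_def)
  then show "v \<in> words A n \<Longrightarrow> word_prob b v > 0 \<Longrightarrow> word_prob b v \<ge> \<eta>" by blast
  have fin: "finite (words A n)" using b by (simp add: labelling_def finite_words)
  let ?K = "{v \<in> words A n. word_prob b v > 0}"
  have "card ?K * \<eta> = (\<Sum>v\<in>?K. \<eta>)" by simp
  also have "\<dots> \<le> (\<Sum>v\<in>?K. word_prob b v)" using ge by (intro sum_mono) auto
  also have "\<dots> \<le> (\<Sum>v\<in>words A n. word_prob b v)"
    using fin by (intro sum_mono2) (auto simp: word_prob_nonneg)
  also have "\<dots> = 1" by (rule sum_word_prob[OF b])
  finally show "card ?K \<le> 1 / \<eta>" using \<eta>(1) by (simp add: field_simps)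
qed

text \<open>
  Every itinerary of positive probability has probability at least \<open>\<eta>\<close>, so the entropies of the
  iterated partitions stay below \<open>ln (1 / \<eta>)\<close>.
\<close>
lemma entropy_zero_of_gap:
  assumes \<eta>: "0 < \<eta>" "\<And>B. B \<in> sets M \<Longrightarrow> prob B = 0 \<or> prob B \<ge> \<eta>" and P: "is_partition M P"
  shows "partition_entropy M T P = 0"
proof -
  have "finer_cover P P" by (auto simp: finer_cover_def)
  then obtain b where b: "labelling M P b"
    "(\<lambda>n. label_entropy P b n / n) \<longlonglongrightarrow> partition_entropy M T P"
    by (rule partition_itinerary_entropy[OF P]) (rule that)
  have "label_entropy P b n \<le> ln (1 / \<eta>)" for n
  proof -
    have "- (word_prob b v * ln (word_prob b v)) \<le> word_prob b v * ln (1 / \<eta>)" if "v \<in> words P n" for v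
    proof (cases "word_prob b v = 0")
      case False
      then have pos: "word_prob b v > 0" using word_prob_nonneg[of b v] by simp
      then have "ln \<eta> \<le> ln (word_prob b v)"
        using card_positive_words_le(2)[OF b(1) \<eta> that] \<eta>(1) by simp
      then have "word_prob b v * ln \<eta> \<le> word_prob b v * ln (word_prob b v)"
        using pos by (intro mult_left_mono) auto
      then show ?thesis using \<eta>(1) by (simp add: ln_div)
    qed simp
    then have "label_entropy P b n \<le> (\<Sum>v\<in>words P n. word_prob b v * ln (1 / \<eta>))"
      unfolding label_entropy_def sum_negf[symmetric] by (intro sum_mono)
    also have "\<dots> = ln (1 / \<eta>)" by (simp add: sum_word_prob[OF b(1)] flip: sum_distrib_right)
    finally show ?thesis .
  qed
  then have "label_entropy P b n / n \<le> ln (1 / \<eta>) / n" for n by (intro divide_right_mono) auto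
  then have "(\<lambda>n. label_entropy P b n / n) \<longlonglongrightarrow> 0"
    by (intro tendsto_sandwich[OF _ _ tendsto_const lim_const_over_n[of "ln (1 / \<eta>)"]])
       (auto simp: label_entropy_nonneg)
  then show ?thesis using b(2) LIMSEQ_unique by blast
qed

lemma cover_number_bounded_of_gap:
  assumes \<eta>: "0 < \<eta>" "\<And>B. B \<in> sets M \<Longrightarrow> prob B = 0 \<or> prob B \<ge> \<eta>" and U: "is_cover M U"
    and "\<epsilon> > 0"
  shows "cover_number M (iterated_cover M T U n) \<epsilon> \<le> 1 / \<eta>"
proof -
  obtain b where b: "labelling M U b" "\<And>x. x \<in> space M \<Longrightarrow> x \<in> b x"
    using cover_labelling[OF U] by blast
  let ?K = "{v \<in> words U n. word_prob b v > 0}"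
  have "(\<Sum>v\<in>words U n - ?K. word_prob b v) = 0"
    using word_prob_nonneg[of b] by (intro sum.neutral) (auto simp: not_less intro: antisym)
  then have "cover_number M (iterated_cover M T U n) \<epsilon> \<le> card ?K"
    using b(2) \<open>\<epsilon> > 0\<close> by (intro cover_number_le_itinerary[OF b(1), of id]) auto
  then show ?thesis using card_positive_words_le(1)[OF b(1) \<eta>, of n] by linarith
qed

end

section \<open>The common limit of the growth rates\<close>

context ergodic_dynamical_system
begin

lemma growth_rate_nonneg:
  assumes "is_cover M U" "0 < \<epsilon>" "\<epsilon> < 1"
  shows "cover_growth_rate M T U \<epsilon> n \<ge> 0"
  using cover_number_ge_1[OF assms(1,2), of n] assms(3) by (simp add: cover_growth_rate_def)

lemma growth_rate_le_iff:
  assumes "is_cover M U" "0 < \<epsilon>" "\<epsilon> < 1" "n \<ge> 1"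
  shows "cover_growth_rate M T U \<epsilon> n \<le> h \<longleftrightarrow>
    cover_number M (iterated_cover M T U n) \<epsilon> \<le> exp (n * h)"
proof -
  have "real (cover_number M (iterated_cover M T U n) \<epsilon>) > 0"
    using cover_number_ge_1[OF assms(1,2), of n] assms(3) by simp
  then have "ln (cover_number M (iterated_cover M T U n) \<epsilon>) \<le> n * h \<longleftrightarrow>
      cover_number M (iterated_cover M T U n) \<epsilon> \<le> exp (n * h)"
    using exp_le_cancel_iff[of "ln (cover_number M (iterated_cover M T U n) \<epsilon>)" "n * h"] by simp
  then show ?thesis
    using assms(4) by (simp add: cover_growth_rate_def divide_le_eq mult.commute)
qed

lemma growth_rate_tendsto:
  assumes U: "is_cover M U" and \<epsilon>: "0 < \<epsilon>" "\<epsilon> < 1"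
  shows "cover_growth_rate M T U \<epsilon> \<longlonglongrightarrow> cover_entropy_plus M T U"
proof -
  let ?E = "{partition_entropy M T P |P. is_partition M P \<and> finer_cover P U}"
  let ?h = "cover_entropy_plus M T U"
  have bdd: "bdd_below ?E" by (rule bdd_belowI[of _ 0]) (auto simp: partition_entropy_nonneg)
  obtain P0 where P0: "is_partition M P0" "finer_cover P0 U"
    by (rule exists_finer_partition[OF U])
  then have nonempty: "?E \<noteq> {}" by blast
  have h_le: "?h \<le> partition_entropy M T P" if "is_partition M P" "finer_cover P U" for P
    unfolding cover_entropy_plus_def by (rule cInf_lower[OF _ bdd]) (use that in blast)
  have h_nonneg: "?h \<ge> 0"
    unfolding cover_entropy_plus_def
    by (rule cInf_greatest[OF nonempty]) (auto simp: partition_entropy_nonneg)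
  show ?thesis
  proof (cases "\<exists>\<eta>>0. \<forall>B\<in>sets M. prob B = 0 \<or> prob B \<ge> \<eta>")
    case True
    then obtain \<eta> where \<eta>: "0 < \<eta>" "\<And>B. B \<in> sets M \<Longrightarrow> prob B = 0 \<or> prob B \<ge> \<eta>" by blast
    have h0: "?h = 0" using h_nonneg h_le[OF P0] entropy_zero_of_gap[OF \<eta> P0(1)] by simp
    have upper: "cover_growth_rate M T U \<epsilon> n \<le> ln (1 / \<eta>) / n" for n
    proof -
      have "real (cover_number M (iterated_cover M T U n) \<epsilon>) > 0"
        using cover_number_ge_1[OF U \<epsilon>(1), of n] \<epsilon>(2) by simp
      then have "ln (cover_number M (iterated_cover M T U n) \<epsilon>) \<le> ln (1 / \<eta>)"
        using cover_number_bounded_of_gap[OF \<eta> U \<epsilon>(1), of n] by (intro ln_mono)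
      then show ?thesis unfolding cover_growth_rate_def by (intro divide_right_mono) auto
    qed
    show ?thesis
      unfolding h0 using upper growth_rate_nonneg[OF U \<epsilon>]
      by (intro tendsto_sandwich[OF _ _ tendsto_const lim_const_over_n[of "ln (1 / \<eta>)"]]) auto
  next
    case False
    have small: "\<forall>\<eta>>0. \<exists>B\<in>sets M. 0 < prob B \<and> prob B < \<eta>"
    proof (intro allI impI)
      fix \<eta> :: real assume \<eta>: "\<eta> > 0"
      obtain B where "B \<in> sets M" "prob B \<noteq> 0" "prob B < \<eta>"
        using False \<eta> by (auto simp: not_le)
      then show "\<exists>B\<in>sets M. 0 < prob B \<and> prob B < \<eta>" by (intro bexI[of _ B]) (auto simp: zero_less_measure_iff)
    qed
    show ?thesis
    proof (rule order_tendstoI)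
      fix h assume "h < ?h"
      show "\<forall>\<^sub>F n in sequentially. h < cover_growth_rate M T U \<epsilon> n"
      proof (rule ccontr)
        \<comment> \<open>Infinitely many small covering numbers would produce a partition of entropy below the infimum.\<close>
        assume "\<not> ?thesis"
        then have inf: "\<exists>\<^sub>\<infinity>n. cover_growth_rate M T U \<epsilon> n \<le> h"
          by (simp add: not_eventually not_less cofinite_eq_sequentially)
        then obtain n where "cover_growth_rate M T U \<epsilon> n \<le> h" using INFM_EX by blast
        then have h0: "0 \<le> h" using growth_rate_nonneg[OF U \<epsilon>, of n] by linarith
        have "\<exists>\<^sub>\<infinity>n. cover_number M (iterated_cover M T U n) \<epsilon> \<le> exp (n * h)"
          unfolding INFM_nat_le
        proof
          fix m
          obtain n where "n \<ge> max 1 m" "cover_growth_rate M T U \<epsilon> n \<le> h"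
            using inf unfolding INFM_nat_le by blast
          then show "\<exists>n\<ge>m. cover_number M (iterated_cover M T U n) \<epsilon> \<le> exp (n * h)"
            using growth_rate_le_iff[OF U \<epsilon>, of n h] by auto
        qed
        from exists_low_entropy_partition[OF U h0 \<epsilon> this small, of "(?h - h) / 2"] \<open>h < ?h\<close>
        obtain P where "is_partition M P" "finer_cover P U" "partition_entropy M T P \<le> h + (?h - h) / 2"
          by auto
        then show False using h_le[of P] \<open>h < ?h\<close> by (simp add: field_simps)
      qed
    next
      fix h assume "?h < h"
      define h0 where "h0 = (?h + h) / 2"
      have h0: "?h < h0" "h0 < h" using \<open>?h < h\<close> by (auto simp: h0_def)
      obtain P where P: "is_partition M P" "finer_cover P U" "partition_entropy M T P < h0"
        using h0(1) cInf_lessD[OF nonempty, of h0] unfolding cover_entropy_plus_def by blast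
      obtain b c where b: "labelling M P b" "c ` P \<subseteq> U" "\<And>x. x \<in> space M \<Longrightarrow> x \<in> c (b x)"
        "(\<lambda>n. label_entropy P b n / n) \<longlonglongrightarrow> partition_entropy M T P"
        by (rule partition_itinerary_entropy[OF P(1,2)]) (rule that)
      \<comment> \<open>This \<open>\<epsilon>1\<close> is admissible for the information bound; \<open>cover_number_eventually_le\<close> then passes to \<open>\<epsilon>\<close>.\<close>
      obtain h1 where h1: "partition_entropy M T P < h1" "h1 < h0" using dense[OF P(3)] by blast
      have pos: "0 < h1" using h1(1) partition_entropy_nonneg[OF P(1)] by linarith
      have "h1 / h0 < 1" using pos h1(2) by simp
      then obtain \<epsilon>1 where \<epsilon>1: "h1 / h0 < \<epsilon>1" "\<epsilon>1 < 1" using dense by blast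
      have \<epsilon>1_pos: "0 < \<epsilon>1" using \<epsilon>1(1) pos h1(2) divide_pos_pos[of h1 h0] by linarith
      have "\<forall>\<^sub>F n in sequentially. label_entropy P b n / n < h1"
        using order_tendstoD(2)[OF b(4) h1(1)] .
      then have "\<forall>\<^sub>F n in sequentially. cover_number M (iterated_cover M T U n) \<epsilon>1 \<le> exp (n * h0)"
        using eventually_ge_at_top[of 1]
      proof eventually_elim
        case (elim n)
        then have "label_entropy P b n \<le> n * h1" by (simp add: field_simps)
        then show ?case
          using elim(2) h1(2) pos \<epsilon>1(1) by (intro cover_number_le_exp_entropy[OF b(1-3)]) auto
      qed
      then have freq: "\<exists>\<^sub>\<infinity>n. cover_number M (iterated_cover M T U n) \<epsilon>1 \<le> exp (n * h0)"
        unfolding cofinite_eq_sequentially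
        by (rule eventually_frequently[OF trivial_limit_sequentially])
      have "0 \<le> h0" "0 < (h - h0) / 2" using pos h1(2) h0 by auto
      from cover_number_eventually_le[OF U this(1) \<epsilon>1_pos \<epsilon>1(2) freq small this(2) \<epsilon>(1)]
      have "\<forall>\<^sub>F n in sequentially.
          cover_number M (iterated_cover M T U n) \<epsilon> \<le> exp (n * (h0 + (h - h0) / 2))" .
      then show "\<forall>\<^sub>F n in sequentially. cover_growth_rate M T U \<epsilon> n < h"
        using eventually_ge_at_top[of 1]
      proof eventually_elim
        case (elim n)
        then have "cover_growth_rate M T U \<epsilon> n \<le> h0 + (h - h0) / 2"
          using growth_rate_le_iff[OF U \<epsilon>] by simp
        also have "\<dots> < h" using h0(2) by (simp add: field_simps)
        finally show ?case .
      qed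
    qed
  qed
qed

end

theorem theorem4p4:
  fixes M :: "'a measure" and T :: "'a \<Rightarrow> 'a" and U :: "'a set set"
  assumes "ergodic_dynamical_system M T"
    and "is_cover M U"
  shows "cover_entropy_e_well_defined M T U \<and>
         cover_entropy_e M T U = cover_entropy_plus M T U"
proof -
  interpret ergodic_dynamical_system M T by (rule assms(1))
  let ?h = "cover_entropy_plus M T U"
  have lim: "\<forall>\<epsilon>. 0 < \<epsilon> \<and> \<epsilon> < 1 \<longrightarrow> cover_growth_rate M T U \<epsilon> \<longlonglongrightarrow> ?h"
    using growth_rate_tendsto[OF assms(2)] by blast
  have "cover_entropy_e M T U = ?h"
    unfolding cover_entropy_e_def
  proof (rule the_equality)
    fix h assume "\<forall>\<epsilon>. 0 < \<epsilon> \<and> \<epsilon> < 1 \<longrightarrow> cover_growth_rate M T U \<epsilon> \<longlonglongrightarrow> h"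
    then have "cover_growth_rate M T U (1/2) \<longlonglongrightarrow> h" by simp
    moreover have "cover_growth_rate M T U (1/2) \<longlonglongrightarrow> ?h" using lim by simp
    ultimately show "h = ?h" by (rule LIMSEQ_unique)
  qed (rule lim)
  then show ?thesis using lim unfolding cover_entropy_e_well_defined_def by blast
qed

end
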